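(* Let $G$ be a $d$-regular graph on $n$ vertices which is bicycle-free at radius $r \geq 10\ln(2\ell)$. Then the number of singleton-free $(\ell-1)$-hikes in $G$ is at most $$O(\ell^3 n)\cdot (d-1)^{\ell}\cdot (d r \ell)^{O\left(\frac{\log \ell}{r}\right)\cdot \ell}.$$
   Context: An $(\ell-1)$-hike in $G$ is a closed walk of exactly $2(\ell-1)$ steps which is non-backtracking (no step is the reverse of the preceding step) except possibly between the $(\ell-1)$th and $\ell$th steps; it is singleton-free if every undirected edge it traverses is traversed at least twice. A connected multigraph $H$ is bicycle-free if $|E(H)|-|V(H)| \le 0$; $G$ is bicycle-free at radius $r$ if every vertex's distance-$r$ neighborhood is bicycle-free.
   Formalization: The degree is assumed to satisfy d ≥ 2 (and ℓ ≥ 1): for d = 1 and ℓ = 2 a perfect matching has n singleton-free 1-hikes while the bound, containing (d−1)^ℓ, is 0. *)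

theory Defs
  imports Complex_Main "Graph_Theory.Digraph_Component" "Graph_Theory.Shortest_Path"
begin

text \<open>
  An undirected simple graph is the locale \<^verbatim>\<open>graph\<close>: a finite symmetric digraph without loops
  and parallel arcs, in which the undirected edge \<open>{u, v}\<close> is the pair of arcs from \<open>u\<close> to
  \<open>v\<close> and from \<open>v\<close> to \<open>u\<close>.
\<close>

definition uedge :: "('a, 'b) pre_digraph \<Rightarrow> 'b \<Rightarrow> 'a set" where
  "uedge G e = {tail G e, head G e}"

definition uedges :: "('a, 'b) pre_digraph \<Rightarrow> 'a set set" where
  "uedges G = uedge G ` arcs G"

definition regular :: "('a, 'b) pre_digraph \<Rightarrow> nat \<Rightarrow> bool" where
  "regular G d \<longleftrightarrow> (\<forall>v \<in> verts G. out_degree G v = d)"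

definition excess :: "('a, 'b) pre_digraph \<Rightarrow> int" where
  "excess H = int (card (uedges H)) - int (card (verts H))"

text \<open>Only applied to neighborhoods of a vertex, which are connected.\<close>

definition bicycle_free :: "('a, 'b) pre_digraph \<Rightarrow> bool" where
  "bicycle_free H \<longleftrightarrow> excess H \<le> 0"

definition neighborhood :: "('a, 'b) pre_digraph \<Rightarrow> real \<Rightarrow> 'a \<Rightarrow> ('a, 'b) pre_digraph" where
  "neighborhood G r v = G \<restriction> {w \<in> verts G. wf_digraph.\<mu> G (\<lambda>_. 1) v w \<le> ereal r}"

definition bicycle_free_at_radius :: "('a, 'b) pre_digraph \<Rightarrow> real \<Rightarrow> bool" where
  "bicycle_free_at_radius G r \<longleftrightarrow> (\<forall>v \<in> verts G. bicycle_free (neighborhood G r v))"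

definition is_reverse :: "('a, 'b) pre_digraph \<Rightarrow> 'b \<Rightarrow> 'b \<Rightarrow> bool" where
  "is_reverse G e f \<longleftrightarrow> tail G f = head G e \<and> head G f = tail G e"

text \<open>
  A walk is given by its start vertex \<open>u\<close> and its list of arcs \<open>p\<close>, so that there is one empty
  walk per vertex. Step \<open>j\<close> is \<open>p ! (j - 1)\<close>; the turn between steps \<open>k\<close> and \<open>k + 1\<close>, which is
  allowed to backtrack, is therefore the one from \<open>p ! (k - 1)\<close> to \<open>p ! k\<close>. The turn from the last
  step to the first one is not constrained either.
\<close>

definition hike :: "('a, 'b) pre_digraph \<Rightarrow> nat \<Rightarrow> 'a \<Rightarrow> 'b list \<Rightarrow> bool" where
  "hike G k u p \<longleftrightarrow> pre_digraph.awalk G u p u \<and> length p = 2 * k \<and>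
     (\<forall>i. Suc i < length p \<and> Suc i \<noteq> k \<longrightarrow> \<not> is_reverse G (p ! i) (p ! Suc i))"

definition singleton_free :: "('a, 'b) pre_digraph \<Rightarrow> 'b list \<Rightarrow> bool" where
  "singleton_free G p \<longleftrightarrow>
     (\<forall>e \<in> set p. 2 \<le> card {i. i < length p \<and> uedge G (p ! i) = uedge G e})"

definition singleton_free_hikes :: "('a, 'b) pre_digraph \<Rightarrow> nat \<Rightarrow> ('a \<times> 'b list) set" where
  "singleton_free_hikes G k = {(u, p). hike G k u p \<and> singleton_free G p}"

end

theory Submission
  imports Defs
begin

text \<open>
  Two ideas carry the count. First, a subgraph with at most \<open>l\<close> vertices has small excess: intersect
  it with growing balls around one of its vertices until one more layer enlarges the intersection by
  a factor of at most \<open>1 + \<delta>\<close>, which happens within radius \<open>r\<close> for \<open>\<delta>\<close> of order \<open>ln l / r\<close>. All its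
  edges meeting this ball lie in the next ball, which is bicycle-free, so deleting the ball removes
  at most \<open>1 + \<delta>\<close> edges per vertex; iterate. Second, a ball of radius \<open>r\<close> is a tree plus at most one
  edge, and a non-backtracking walk inside it with given ends is determined by how often, and in
  which direction, it uses the extra edge.

  Now split the steps of a hike into those along a new edge, of which there are at most \<open>l - 1\<close>
  because every edge is used twice, and those along an old edge. A new step costs a factor \<open>d - 1\<close>.
  A stretch of at most \<open>r\<close> old steps is determined, up to few choices, by its end point, which was
  visited before. Apart from the turn, a hike passes from a new to an old edge only after closing
  a cycle, so the number of stretches, and of patterns of new and old steps, is controlled by the
  excess. If \<open>r\<close> is at least \<open>l - 1\<close>, the first half of the hike alone determines the second up to
  \<open>O(l)\<close> choices.
\<close>

section \<open>Non-backtracking walks in a forest with one extra edge\<close>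

definition nonbacktracking :: "'a list \<Rightarrow> bool" where
  "nonbacktracking xs \<longleftrightarrow> (\<forall>i. Suc (Suc i) < length xs \<longrightarrow> xs ! i \<noteq> xs ! Suc (Suc i))"

lemma nonbacktracking_rev: "nonbacktracking (rev xs) \<longleftrightarrow> nonbacktracking xs"
proof -
  have "nonbacktracking (rev ys)" if "nonbacktracking ys" for ys :: "'a list"
    unfolding nonbacktracking_def
  proof (intro allI impI)
    fix i assume i: "Suc (Suc i) < length (rev ys)"
    define j where "j = length ys - Suc (Suc (Suc i))"
    have "ys ! j \<noteq> ys ! Suc (Suc j)"
      using that i unfolding nonbacktracking_def j_def by auto
    moreover have "rev ys ! i = ys ! Suc (Suc j)" "rev ys ! Suc (Suc i) = ys ! j"
      using i by (auto simp: rev_nth j_def Suc_diff_Suc intro!: arg_cong[where f = "(!) ys"])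
    ultimately show "rev ys ! i \<noteq> rev ys ! Suc (Suc i)" by simp
  qed
  from this[of xs] this[of "rev xs"] show ?thesis by auto
qed

lemma nonbacktracking_appendD1: "nonbacktracking (xs @ ys) \<Longrightarrow> nonbacktracking xs"
  unfolding nonbacktracking_def by (auto simp: nth_append split: if_splits)

lemma nonbacktracking_appendD2: "nonbacktracking (xs @ ys) \<Longrightarrow> nonbacktracking ys"
  using nonbacktracking_appendD1[of "rev ys" "rev xs"] by (metis nonbacktracking_rev rev_append)

lemma nonbacktracking_Cons_Cons:
  "nonbacktracking (x # y # zs) \<longleftrightarrow> (zs \<noteq> [] \<longrightarrow> x \<noteq> hd zs) \<and> nonbacktracking (y # zs)"
  by (cases zs) (simp_all add: nonbacktracking_def All_less_Suc2)

definition nb_walk :: "('a \<Rightarrow> 'a \<Rightarrow> bool) \<Rightarrow> 'a list \<Rightarrow> bool" where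
  "nb_walk E p \<longleftrightarrow> p \<noteq> [] \<and> successively E p \<and> nonbacktracking p"

definition nb_walks :: "('a \<Rightarrow> 'a \<Rightarrow> bool) \<Rightarrow> nat \<Rightarrow> 'a \<Rightarrow> 'a \<Rightarrow> 'a list set" where
  "nb_walks E m x y = {p. nb_walk E p \<and> length p = Suc m \<and> hd p = x \<and> last p = y}"

lemma nb_walk_Cons_Cons:
  "nb_walk E (x # y # zs) \<longleftrightarrow> E x y \<and> (zs \<noteq> [] \<longrightarrow> x \<noteq> hd zs) \<and> nb_walk E (y # zs)"
  by (auto simp: nb_walk_def nonbacktracking_Cons_Cons)

lemma nb_walk_rev:
  assumes "symp E"
  shows "nb_walk E (rev p) \<longleftrightarrow> nb_walk E p"
proof -
  have "(\<lambda>x y. E y x) = E" using assms by (auto simp: symp_def fun_eq_iff)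
  then show ?thesis by (simp only: nb_walk_def nonbacktracking_rev successively_rev rev_is_Nil_conv)
qed

lemma nb_walk_appendD1: "nb_walk E (p @ q) \<Longrightarrow> p \<noteq> [] \<Longrightarrow> nb_walk E p"
  by (auto simp: nb_walk_def successively_append_iff dest: nonbacktracking_appendD1)

lemma nb_walk_appendD2: "nb_walk E (p @ q) \<Longrightarrow> q \<noteq> [] \<Longrightarrow> nb_walk E q"
  by (auto simp: nb_walk_def successively_append_iff dest: nonbacktracking_appendD2)

lemma nb_walk_turn: "nb_walk E (p @ [x, y, z] @ q) \<Longrightarrow> x \<noteq> z"
  using nb_walk_appendD2[of E p "[x, y, z] @ q"] by (simp add: nb_walk_Cons_Cons)

definition add_edge :: "('a \<Rightarrow> 'a \<Rightarrow> bool) \<Rightarrow> 'a set \<Rightarrow> 'a \<Rightarrow> 'a \<Rightarrow> bool" where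
  "add_edge E e u v \<longleftrightarrow> E u v \<or> {u, v} = e"

fun traversals :: "'a set \<Rightarrow> 'a list \<Rightarrow> ('a \<times> 'a) list" where
  "traversals e (x # y # zs) =
     (if {x, y} = e then (x, y) # traversals e (y # zs) else traversals e (y # zs))"
| "traversals e _ = []"

lemma length_traversals_le: "length (traversals e p) \<le> length p - 1"
proof (induction e p rule: traversals.induct)
  case (1 e x y zs)
  then show ?case by (cases "{x, y} = e") simp_all
qed simp_all

lemma nb_walk_without_traversals:
  "nb_walk (add_edge E e) p \<Longrightarrow> traversals e p = [] \<Longrightarrow> nb_walk E p"
proof (induction e p rule: traversals.induct)
  case (1 e x y zs)
  then show ?case by (cases "{x, y} = e") (simp_all add: nb_walk_Cons_Cons add_edge_def)
qed (simp_all add: nb_walk_def nonbacktracking_def)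

lemma traversals_ConsD:
  assumes "traversals e p = (u, v) # ts"
  shows "\<exists>p\<^sub>1 p\<^sub>2. p = p\<^sub>1 @ p\<^sub>2 \<and> p\<^sub>1 \<noteq> [] \<and> p\<^sub>2 \<noteq> [] \<and> last p\<^sub>1 = u \<and> hd p\<^sub>2 = v \<and> {u, v} = e \<and>
    traversals e p\<^sub>1 = [] \<and> traversals e p\<^sub>2 = ts"
  using assms
proof (induction e p rule: traversals.induct)
  case (1 e x y zs)
  show ?case
  proof (cases "{x, y} = e")
    case True
    then have "u = x" "v = y" "traversals e (y # zs) = ts" using "1.prems" by auto
    then show ?thesis using True by (intro exI[of _ "[x]"] exI[of _ "y # zs"]) simp
  next
    case False
    then have "traversals e (y # zs) = (u, v) # ts" using "1.prems" by simp
    from "1.IH"(2)[OF False this]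
    obtain p\<^sub>1 p\<^sub>2 where split: "y # zs = p\<^sub>1 @ p\<^sub>2" "p\<^sub>1 \<noteq> []" "p\<^sub>2 \<noteq> []"
      "last p\<^sub>1 = u" "hd p\<^sub>2 = v" "{u, v} = e" "traversals e p\<^sub>1 = []" "traversals e p\<^sub>2 = ts"
      by blast
    obtain p\<^sub>1' where "p\<^sub>1 = y # p\<^sub>1'" using split by (cases p\<^sub>1) auto
    then show ?thesis using split False by (intro exI[of _ "x # p\<^sub>1"] exI[of _ p\<^sub>2]) auto
  qed
qed auto

lemma nb_walk_first_traversalE:
  assumes "nb_walk (add_edge E e) p" "traversals e p = (u, v) # ts"
  obtains p\<^sub>1 p\<^sub>2 where "p = p\<^sub>1 @ p\<^sub>2" "nb_walk E p\<^sub>1" "nb_walk (add_edge E e) p\<^sub>2"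
    "last p\<^sub>1 = u" "hd p\<^sub>2 = v" "{u, v} = e" "traversals e p\<^sub>2 = ts"
proof -
  obtain p\<^sub>1 p\<^sub>2 where "p = p\<^sub>1 @ p\<^sub>2" "p\<^sub>1 \<noteq> []" "p\<^sub>2 \<noteq> []" "last p\<^sub>1 = u" "hd p\<^sub>2 = v"
    "{u, v} = e" "traversals e p\<^sub>1 = []" "traversals e p\<^sub>2 = ts"
    using traversals_ConsD[OF assms(2)] by blast
  moreover from this have "nb_walk E p\<^sub>1" "nb_walk (add_edge E e) p\<^sub>2"
    using assms(1) nb_walk_appendD1 nb_walk_appendD2 by (blast intro: nb_walk_without_traversals)+
  ultimately show thesis by (intro that)
qed

definition forest_adj :: "('a \<Rightarrow> 'a \<Rightarrow> bool) \<Rightarrow> 'a \<Rightarrow> 'a \<Rightarrow> bool" where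
  "forest_adj up u v \<longleftrightarrow> up u v \<or> up v u"

lemma symp_forest_adj: "symp (forest_adj up)"
  by (auto simp: symp_def forest_adj_def)

locale rooted_forest =
  fixes up :: "'a \<Rightarrow> 'a \<Rightarrow> bool" and depth :: "'a \<Rightarrow> nat"
  assumes up_unique: "up u v \<Longrightarrow> up u w \<Longrightarrow> v = w"
    and depth_up: "up u v \<Longrightarrow> depth v < depth u"
begin

lemma nb_walk_descends:
  assumes "nb_walk (forest_adj up) (x # y # zs)" "up y x"
  shows "depth x < depth (last (y # zs))"
  using assms
proof (induction zs arbitrary: x y)
  case Nil
  then show ?case using depth_up by simp
next
  case (Cons z zs)
  then have "x \<noteq> z" "forest_adj up y z" by (simp_all add: nb_walk_Cons_Cons)
  then have "up z y" using Cons.prems(2) up_unique by (auto simp: forest_adj_def)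
  then have "depth y < depth (last (z # zs))"
    using Cons.prems(1) by (intro Cons.IH) (simp_all add: nb_walk_Cons_Cons)
  then show ?case using depth_up[OF Cons.prems(2)] by simp
qed

lemma nb_walk_first_step_up:
  assumes "nb_walk (forest_adj up) (x # y # zs)" "depth (last (y # zs)) \<le> depth x"
  shows "up x y"
  using nb_walk_descends[OF assms(1)] assms by (auto simp: nb_walk_Cons_Cons forest_adj_def)

text \<open>Both end steps of a closed walk run between its base point and the parent of that point, so
  stripping them leaves a shorter closed walk.\<close>

lemma closed_nb_walk_trivial:
  assumes "nb_walk (forest_adj up) p" "last p = hd p"
  shows "p = [hd p]"
  using assms
proof (induction p rule: measure_induct_rule[of length])
  case (less p)
  obtain x r where p: "p = x # r" using less.prems(1) by (cases p) (auto simp: nb_walk_def)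
  show ?case
  proof (cases r rule: rev_cases)
    case (snoc mid x')
    then have p_mid: "p = x # mid @ [x]" using p less.prems(2) by simp
    have "mid \<noteq> []"
      using less.prems(1) depth_up[of x x] by (auto simp: p_mid nb_walk_Cons_Cons forest_adj_def)
    then obtain us y where us: "mid = us @ [y]" by (cases mid rule: rev_cases) auto
    have mid_walk: "nb_walk (forest_adj up) mid"
      using less.prems(1) \<open>mid \<noteq> []\<close> nb_walk_appendD1[of _ "x # mid" "[x]"]
        nb_walk_appendD2[of _ "[x]" mid]
      by (simp add: p_mid)
    have "nb_walk (forest_adj up) (x # y # rev us @ [x])"
      using less.prems(1) nb_walk_rev[OF symp_forest_adj, of up p] by (simp add: p_mid us)
    then have "up x y" by (rule nb_walk_first_step_up) simp
    moreover have "nb_walk (forest_adj up) (x # hd mid # tl mid @ [x])"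
      using less.prems(1) \<open>mid \<noteq> []\<close> by (cases mid) (simp_all add: p_mid)
    then have "up x (hd mid)" by (rule nb_walk_first_step_up) simp
    ultimately have "last mid = hd mid" using up_unique us by auto
    then have "mid = [hd mid]" using less.IH mid_walk by (simp add: p_mid)
    then show ?thesis
      using less.prems(1) nb_walk_turn[of _ "[]" x "hd mid" x "[]"] by (metis append.simps p_mid)
  qed (simp add: p)
qed

lemma nb_walks_share_first_step:
  assumes "nb_walk (forest_adj up) p" "nb_walk (forest_adj up) q" "hd p = hd q" "last p = last q"
    and "depth (last p) \<le> depth (hd p)"
  shows "p = q \<or> (\<exists>x y ps qs. p = x # y # ps \<and> q = x # y # qs)"
proof -
  obtain x p' where p: "p = x # p'" using assms(1) by (cases p) (auto simp: nb_walk_def)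
  obtain q' where q: "q = x # q'" using assms(2,3) p by (cases q) (auto simp: nb_walk_def)
  show ?thesis
  proof (cases "p' = [] \<or> q' = []")
    case True
    then have "last p = hd p" "last q = hd q" using assms(3,4) p q by auto
    then show ?thesis using closed_nb_walk_trivial assms(1-3) by metis
  next
    case False
    then obtain y ps z qs where p': "p' = y # ps" and q': "q' = z # qs"
      by (cases p'; cases q') auto
    have "up x y" "up x z"
      using assms nb_walk_first_step_up[of x y ps] nb_walk_first_step_up[of x z qs]
      by (simp_all add: p q p' q')
    then have "y = z" by (rule up_unique)
    then show ?thesis by (simp add: p q p' q')
  qed
qed

lemma nb_walk_unique:
  assumes "nb_walk (forest_adj up) p" "nb_walk (forest_adj up) q" "hd p = hd q" "last p = last q"
  shows "p = q"
  using assms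
proof (induction "length p + length q" arbitrary: p q rule: less_induct)
  case less
  have eq_if_up: "p' = q'"
    if walks: "nb_walk (forest_adj up) p'" "nb_walk (forest_adj up) q'"
        "hd p' = hd q'" "last p' = last q'"
      and depth: "depth (last p') \<le> depth (hd p')"
      and len: "length p' + length q' = length p + length q" for p' q'
    using nb_walks_share_first_step[OF walks depth]
  proof (elim disjE exE conjE)
    fix x y ps qs assume p': "p' = x # y # ps" and q': "q' = x # y # qs"
    then have "nb_walk (forest_adj up) (y # ps)" "nb_walk (forest_adj up) (y # qs)"
      using walks(1,2) by (simp_all add: nb_walk_Cons_Cons)
    then show ?thesis using less.hyps[of "y # ps" "y # qs"] walks(4) len p' q' by simp
  qed
  show ?case
  proof (cases "depth (last p) \<le> depth (hd p)")
    case True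
    then show ?thesis using eq_if_up less.prems by blast
  next
    case False
    then have "rev p = rev q"
      using less.prems
      by (intro eq_if_up) (auto simp: nb_walk_rev symp_forest_adj hd_rev last_rev)
    then show ?thesis by simp
  qed
qed

lemma nb_walk_eq_if_traversals_eq:
  assumes "nb_walk (add_edge (forest_adj up) e) p" "nb_walk (add_edge (forest_adj up) e) q"
    and "hd p = hd q" "last p = last q" "traversals e p = traversals e q"
  shows "p = q"
  using assms
proof (induction "traversals e p" arbitrary: p q)
  case Nil
  then show ?case by (intro nb_walk_unique) (auto intro: nb_walk_without_traversals)
next
  case (Cons t ts)
  obtain u v where t: "t = (u, v)" by (cases t)
  obtain p\<^sub>1 p\<^sub>2 where p: "p = p\<^sub>1 @ p\<^sub>2" "nb_walk (forest_adj up) p\<^sub>1"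
    "nb_walk (add_edge (forest_adj up) e) p\<^sub>2" "last p\<^sub>1 = u" "hd p\<^sub>2 = v" "traversals e p\<^sub>2 = ts"
    using nb_walk_first_traversalE[OF Cons.prems(1)] Cons.hyps(2) t by metis
  obtain q\<^sub>1 q\<^sub>2 where q: "q = q\<^sub>1 @ q\<^sub>2" "nb_walk (forest_adj up) q\<^sub>1"
    "nb_walk (add_edge (forest_adj up) e) q\<^sub>2" "last q\<^sub>1 = u" "hd q\<^sub>2 = v" "traversals e q\<^sub>2 = ts"
    using nb_walk_first_traversalE[OF Cons.prems(2)] Cons.hyps(2) Cons.prems(5) t by metis
  have ne: "p\<^sub>1 \<noteq> []" "p\<^sub>2 \<noteq> []" "q\<^sub>1 \<noteq> []" "q\<^sub>2 \<noteq> []" using p q by (auto simp: nb_walk_def)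
  have "p\<^sub>1 = q\<^sub>1" using p q ne Cons.prems(3) by (intro nb_walk_unique) auto
  moreover have "p\<^sub>2 = q\<^sub>2" using p q ne Cons.prems(4) by (intro Cons.hyps(1)) auto
  ultimately show ?case using p q by simp
qed

text \<open>Between two traversals in opposite directions the walk would be closed inside the forest,
  hence trivial, and the second traversal would backtrack.\<close>

lemma consecutive_traversals_eq:
  assumes walk: "nb_walk (add_edge (forest_adj up) e) p" and trav: "traversals e p = t # t' # ts"
  shows "t' = t"
proof (rule ccontr)
  assume "t' \<noteq> t"
  obtain u v u' v' where t: "t = (u, v)" "t' = (u', v')" by (cases t; cases t')
  obtain p\<^sub>1 p\<^sub>2 where p: "p = p\<^sub>1 @ p\<^sub>2" "nb_walk (forest_adj up) p\<^sub>1"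
    "nb_walk (add_edge (forest_adj up) e) p\<^sub>2" "last p\<^sub>1 = u" "hd p\<^sub>2 = v" "{u, v} = e"
    "traversals e p\<^sub>2 = t' # ts"
    using nb_walk_first_traversalE[OF walk] trav t by metis
  obtain p\<^sub>3 p\<^sub>4 where p\<^sub>2: "p\<^sub>2 = p\<^sub>3 @ p\<^sub>4" "nb_walk (forest_adj up) p\<^sub>3"
    "nb_walk (add_edge (forest_adj up) e) p\<^sub>4" "last p\<^sub>3 = u'" "hd p\<^sub>4 = v'" "{u', v'} = e"
    using nb_walk_first_traversalE[OF p(3)] p(7) t by metis
  have opposite: "u' = v" "v' = u"
    using \<open>t' \<noteq> t\<close> p(6) p\<^sub>2(6) t by (metis doubleton_eq_iff)+
  have ne: "p\<^sub>1 \<noteq> []" "p\<^sub>3 \<noteq> []" "p\<^sub>4 \<noteq> []" using p p\<^sub>2 by (auto simp: nb_walk_def)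
  have "p\<^sub>3 = [v]" using closed_nb_walk_trivial[of p\<^sub>3] p p\<^sub>2 ne opposite by simp
  moreover have "p\<^sub>1 = butlast p\<^sub>1 @ [u]" using ne p by (metis append_butlast_last_id)
  moreover have "p\<^sub>4 = u # tl p\<^sub>4" using ne p\<^sub>2 opposite by (metis list.collapse)
  ultimately have "p = butlast p\<^sub>1 @ [u, v, u] @ tl p\<^sub>4" using p(1) p\<^sub>2(1) by simp
  then show False using nb_walk_turn walk by metis
qed

lemma traversals_eq_replicate:
  assumes "nb_walk (add_edge (forest_adj up) e) p" "traversals e p = t # ts"
  shows "t # ts = replicate (Suc (length ts)) t"
  using assms
proof (induction ts arbitrary: p t)
  case (Cons t' ts)
  obtain p\<^sub>2 where "nb_walk (add_edge (forest_adj up) e) p\<^sub>2" "traversals e p\<^sub>2 = t' # ts"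
    using nb_walk_first_traversalE[OF Cons.prems(1)] Cons.prems(2) by (metis surj_pair)
  then have "t' # ts = replicate (Suc (length ts)) t'" by (rule Cons.IH)
  moreover have "t' = t" using consecutive_traversals_eq[OF Cons.prems] .
  ultimately show ?case by simp
qed simp

lemma traversals_doubleton_cases:
  assumes "nb_walk (add_edge (forest_adj up) {a, b}) p"
  shows "traversals {a, b} p \<in>
    (\<lambda>j. replicate j (a, b)) ` {..length p - 1} \<union> (\<lambda>j. replicate j (b, a)) ` {..length p - 1}"
proof (cases "traversals {a, b} p")
  case Nil
  then show ?thesis by (auto intro!: image_eqI[of _ _ 0])
next
  case (Cons t ts)
  then have "traversals {a, b} p = replicate (Suc (length ts)) t"
    using traversals_eq_replicate[OF assms] by metis
  moreover have "t = (a, b) \<or> t = (b, a)"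
    using traversals_ConsD[of "{a, b}" p "fst t" "snd t" ts] Cons
    by (cases t) (auto simp: doubleton_eq_iff)
  moreover have "Suc (length ts) \<le> length p - 1"
    using length_traversals_le[of "{a, b}" p] Cons by simp
  ultimately show ?thesis by blast
qed

lemma card_nb_walks_add_edge_le:
  "finite (nb_walks (add_edge (forest_adj up) {a, b}) m x y)"
  "card (nb_walks (add_edge (forest_adj up) {a, b}) m x y) \<le> 2 * Suc m"
proof -
  let ?P = "nb_walks (add_edge (forest_adj up) {a, b}) m x y"
  let ?S = "(\<lambda>j. replicate j (a, b)) ` {..m} \<union> (\<lambda>j. replicate j (b, a)) ` {..m}"
  have inj: "inj_on (traversals {a, b}) ?P"
    by (rule inj_onI, rule nb_walk_eq_if_traversals_eq) (auto simp: nb_walks_def)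
  have sub: "traversals {a, b} ` ?P \<subseteq> ?S"
    using traversals_doubleton_cases[of a b] by (fastforce simp: nb_walks_def)
  have "finite ?S" by simp
  then show "finite ?P" using inj_on_finite[OF inj sub] by blast
  have "card ?P \<le> card ?S" by (rule card_inj_on_le[OF inj sub \<open>finite ?S\<close>])
  also have "\<dots> \<le> card {..m} + card {..m}"
    by (rule order_trans[OF card_Un_le]) (intro add_mono card_image_le finite_atMost)
  finally show "card ?P \<le> 2 * Suc m" by simp
qed

end

section \<open>Balls in bicycle-free graphs\<close>

lemma ex_slow_growth:
  fixes f :: "nat \<Rightarrow> real"
  assumes "0 \<le> \<delta>" "0 < R" "1 \<le> f 0" "f R \<le> (1 + \<delta>) ^ R"
  shows "\<exists>i<R. f (Suc i) \<le> (1 + \<delta>) * f i"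
proof (rule ccontr)
  assume "\<not> ?thesis"
  then have grow: "(1 + \<delta>) * f i < f (Suc i)" if "i < R" for i using that by (auto simp: not_le)
  have power_le: "(1 + \<delta>) ^ i \<le> f i" if "i < R" for i
    using that
  proof (induction i)
    case (Suc i)
    then have "(1 + \<delta>) * (1 + \<delta>) ^ i \<le> (1 + \<delta>) * f i" using assms(1) by (intro mult_left_mono) auto
    then show ?case using grow[of i] Suc.prems by simp
  qed (use assms in simp)
  obtain m where m: "R = Suc m" using assms(2) gr0_implies_Suc by blast
  have "(1 + \<delta>) ^ R \<le> (1 + \<delta>) * f m" using power_le[of m] assms(1) by (simp add: m mult_left_mono)
  then show False using grow[of m] assms(4) m by simp
qed

context graph
begin

lemma adj_sym: "u \<rightarrow>\<^bsub>G\<^esub> v \<Longrightarrow> v \<rightarrow>\<^bsub>G\<^esub> u"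
  using arcs_ends_symmetric[OF sym_arcs] .

lemma uedges_induce: "uedges (G \<restriction> X) = {{u, w} | u w. u \<in> X \<and> w \<in> X \<and> u \<rightarrow>\<^bsub>G\<^esub> w}"
proof (intro equalityI subsetI)
  fix e assume "e \<in> uedges (G \<restriction> X)"
  then obtain a where "a \<in> arcs G" "tail G a \<in> X" "head G a \<in> X" "e = {tail G a, head G a}"
    by (auto simp: uedges_def uedge_def)
  then show "e \<in> {{u, w} | u w. u \<in> X \<and> w \<in> X \<and> u \<rightarrow>\<^bsub>G\<^esub> w}" using in_arcs_imp_in_arcs_ends by blast
next
  fix e assume "e \<in> {{u, w} | u w. u \<in> X \<and> w \<in> X \<and> u \<rightarrow>\<^bsub>G\<^esub> w}"
  then obtain a where "a \<in> arcs G" "e = {tail G a, head G a}" "tail G a \<in> X" "head G a \<in> X"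
    by blast
  then show "e \<in> uedges (G \<restriction> X)" by (auto simp: uedges_def uedge_def)
qed

lemma doubleton_in_uedges_induce: "{u, w} \<in> uedges (G \<restriction> X) \<longleftrightarrow> u \<in> X \<and> w \<in> X \<and> u \<rightarrow>\<^bsub>G\<^esub> w"
  unfolding uedges_induce using adj_sym by (auto simp: doubleton_eq_iff)

lemma finite_uedges_induce: "finite (uedges (G \<restriction> X))"
  by (simp add: uedges_def)

lemma bicycle_free_induce_iff: "bicycle_free (G \<restriction> X) \<longleftrightarrow> card (uedges (G \<restriction> X)) \<le> card X"
  by (simp add: bicycle_free_def excess_def)

definition ball :: "'a \<Rightarrow> nat \<Rightarrow> 'a set" where
  "ball x i = {w. \<exists>p. awalk x p w \<and> length p \<le> i}"

definition distance :: "'a \<Rightarrow> 'a \<Rightarrow> nat" where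
  "distance x w = (LEAST n. \<exists>p. awalk x p w \<and> length p = n)"

lemma ball_mono: "i \<le> j \<Longrightarrow> ball x i \<subseteq> ball x j"
  unfolding ball_def by fastforce

lemma ball_subset_verts: "ball x i \<subseteq> verts G"
  by (auto simp: ball_def)

lemma finite_ball: "finite (ball x i)"
  using ball_subset_verts finite_verts by (rule finite_subset)

lemma center_in_ball: "x \<in> verts G \<Longrightarrow> x \<in> ball x i"
  unfolding ball_def by (auto simp: awalk_Nil_iff intro!: exI[of _ "[]"])

lemma ball_0: "x \<in> verts G \<Longrightarrow> ball x 0 = {x}"
  by (auto simp: ball_def awalk_Nil_iff)

lemma adj_in_ball_Suc:
  assumes "u \<in> ball x i" "u \<rightarrow>\<^bsub>G\<^esub> w"
  shows "w \<in> ball x (Suc i)"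
proof -
  obtain p where p: "awalk x p u" "length p \<le> i" using assms(1) by (auto simp: ball_def)
  obtain e where "e \<in> arcs G" "tail G e = u" "head G e = w" using assms(2) by blast
  then have "awalk x (p @ [e]) w" using awalk_appendI[OF p(1)] arc_implies_awalk by blast
  moreover have "length (p @ [e]) \<le> Suc i" using p(2) by simp
  ultimately show ?thesis unfolding ball_def by blast
qed

lemma walk_subset_ball_last:
  assumes "successively (\<lambda>u v. u \<rightarrow>\<^bsub>G\<^esub> v) p" "p \<noteq> []" "last p \<in> verts G"
  shows "set p \<subseteq> ball (last p) (length p - 1)"
  using assms(2,1,3)
proof (induction p rule: list_nonempty_induct)
  case (single x)
  then show ?case by (simp add: center_in_ball)
next
  case (cons x xs)
  then have tail: "set xs \<subseteq> ball (last xs) (length xs - 1)" by (simp add: successively_Cons)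
  have len: "length xs = Suc (length xs - 1)" using cons.hyps by simp
  have "hd xs \<in> ball (last xs) (length xs - 1)" using tail cons.hyps hd_in_set by blast
  moreover have "hd xs \<rightarrow>\<^bsub>G\<^esub> x"
    using cons.prems(1) cons.hyps adj_sym by (simp add: successively_Cons)
  ultimately have "x \<in> ball (last xs) (length xs)" using adj_in_ball_Suc len by metis
  moreover have "set xs \<subseteq> ball (last xs) (length xs)"
    using tail ball_mono[OF diff_le_self] by (rule order_trans)
  ultimately show ?case using cons.hyps by simp
qed

lemma distance_le: "awalk x p w \<Longrightarrow> distance x w \<le> length p"
  unfolding distance_def by (blast intro: Least_le)

lemma shortest_walkE:
  assumes "w \<in> ball x i"
  obtains p where "awalk x p w" "length p = distance x w" "distance x w \<le> i"
proof -
  obtain p where p: "awalk x p w" "length p \<le> i" using assms by (auto simp: ball_def)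
  have "\<exists>q. awalk x q w \<and> length q = distance x w"
    unfolding distance_def
    by (rule LeastI[of "\<lambda>n. \<exists>q. awalk x q w \<and> length q = n" "length p"]) (use p(1) in blast)
  moreover have "distance x w \<le> i" using distance_le[OF p(1)] p(2) by (rule order_trans)
  ultimately show thesis using that by blast
qed

definition parent :: "'a \<Rightarrow> 'a \<Rightarrow> 'a" where
  "parent x w = (SOME u. u \<rightarrow>\<^bsub>G\<^esub> w \<and> u \<in> ball x (distance x w) \<and> distance x u < distance x w)"

lemma parent:
  assumes "w \<in> ball x i" "w \<noteq> x"
  shows "parent x w \<rightarrow>\<^bsub>G\<^esub> w" "parent x w \<in> ball x i" "distance x (parent x w) < distance x w"
proof -
  obtain p where p: "awalk x p w" "length p = distance x w" and dist: "distance x w \<le> i"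
    using shortest_walkE[OF assms(1)] .
  have "p \<noteq> []" using p(1) assms(2) by (auto simp: awalk_Nil_iff)
  then obtain q e where q: "p = q @ [e]" by (cases p rule: rev_cases) auto
  then have e: "awalk x q (tail G e)" "e \<in> arcs G" "head G e = w"
    using p(1) by (auto simp: awalk_simps)
  have shorter: "length q < distance x w" using p(2) q by simp
  have "tail G e \<rightarrow>\<^bsub>G\<^esub> w" using e in_arcs_imp_in_arcs_ends by blast
  moreover have "tail G e \<in> ball x (distance x w)"
    unfolding ball_def using e(1) less_imp_le[OF shorter] by blast
  moreover have "distance x (tail G e) < distance x w"
    using distance_le[OF e(1)] shorter by simp
  ultimately have "\<exists>u. u \<rightarrow>\<^bsub>G\<^esub> w \<and> u \<in> ball x (distance x w) \<and> distance x u < distance x w"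
    by blast
  then have "parent x w \<rightarrow>\<^bsub>G\<^esub> w \<and> parent x w \<in> ball x (distance x w) \<and>
      distance x (parent x w) < distance x w"
    unfolding parent_def by (rule someI_ex)
  then show "parent x w \<rightarrow>\<^bsub>G\<^esub> w" "parent x w \<in> ball x i" "distance x (parent x w) < distance x w"
    using ball_mono[OF dist] by auto
qed

definition parent_in_ball :: "'a \<Rightarrow> nat \<Rightarrow> 'a \<Rightarrow> 'a \<Rightarrow> bool" where
  "parent_in_ball x i u v \<longleftrightarrow> u \<in> ball x i - {x} \<and> v = parent x u"

lemma rooted_forest_parent_in_ball: "rooted_forest (parent_in_ball x i) (distance x)"
  by unfold_locales (auto simp: parent_in_ball_def parent)

definition parent_edge :: "'a \<Rightarrow> 'a \<Rightarrow> 'a set" where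
  "parent_edge x w = {w, parent x w}"

lemma inj_on_parent_edge: "inj_on (parent_edge x) (ball x i - {x})"
proof (rule inj_onI)
  fix w w' assume "w \<in> ball x i - {x}" "w' \<in> ball x i - {x}" "parent_edge x w = parent_edge x w'"
  then show "w = w'" using parent(3)[of w x i] parent(3)[of w' x i]
    by (fastforce simp: parent_edge_def doubleton_eq_iff)
qed

lemma parent_edge_in_uedges: "w \<in> ball x i - {x} \<Longrightarrow> parent_edge x w \<in> uedges (G \<restriction> ball x i)"
  using parent[of w x i] adj_sym by (simp add: parent_edge_def doubleton_in_uedges_induce)

lemma uedges_induce_subset_layers:
  "uedges (G \<restriction> X) \<subseteq> uedges (G \<restriction> (X \<inter> ball x (Suc i))) \<union> uedges (G \<restriction> (X - ball x i))"
proof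
  fix e assume "e \<in> uedges (G \<restriction> X)"
  then obtain u w where e: "e = {u, w}" "u \<in> X" "w \<in> X" "u \<rightarrow>\<^bsub>G\<^esub> w" by (auto simp: uedges_induce)
  show "e \<in> uedges (G \<restriction> (X \<inter> ball x (Suc i))) \<union> uedges (G \<restriction> (X - ball x i))"
    using e adj_sym[OF e(4)] adj_in_ball_Suc[of _ x i] ball_mono[of i "Suc i" x]
    by (auto simp: doubleton_in_uedges_induce)
qed

lemma ex_slow_layer:
  fixes \<delta> :: real
  assumes "0 < R" "0 \<le> \<delta>" "X \<subseteq> verts G" "real (card X) \<le> (1 + \<delta>) ^ R" "x \<in> X"
  shows "\<exists>i<R. real (card (X \<inter> ball x (Suc i))) \<le> (1 + \<delta>) * real (card (X \<inter> ball x i))"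
proof (rule ex_slow_growth)
  have "X \<inter> ball x 0 = {x}" using assms(3,5) ball_0 by auto
  then show "1 \<le> real (card (X \<inter> ball x 0))" by simp
  have "card (X \<inter> ball x R) \<le> card X"
    using finite_subset[OF assms(3) finite_verts] by (intro card_mono) auto
  then show "real (card (X \<inter> ball x R)) \<le> (1 + \<delta>) ^ R" using assms(4) by linarith
qed (use assms in auto)

end

locale bicycle_free_graph = graph +
  fixes R :: nat
  assumes bicycle_free_ball: "x \<in> verts G \<Longrightarrow> bicycle_free (G \<restriction> ball x R)"
begin

lemma bicycle_free_subset_ball:
  assumes "x \<in> J" and J: "J \<subseteq> ball x R"
  shows "bicycle_free (G \<restriction> J)"
proof -
  have x: "x \<in> verts G" using assms ball_subset_verts by blast
  have disj: "uedges (G \<restriction> J) \<inter> parent_edge x ` (ball x R - J) = {}"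
    by (auto simp: uedges_induce parent_edge_def doubleton_eq_iff)
  have inj: "inj_on (parent_edge x) (ball x R - J)"
    using inj_on_parent_edge[of x R] by (rule inj_on_subset) (use assms in auto)
  have "uedges (G \<restriction> J) \<subseteq> uedges (G \<restriction> ball x R)" using J by (auto simp: uedges_induce)
  moreover have "parent_edge x ` (ball x R - J) \<subseteq> uedges (G \<restriction> ball x R)"
    using parent_edge_in_uedges[of _ x R] assms by blast
  ultimately have sub: "uedges (G \<restriction> J) \<union> parent_edge x ` (ball x R - J) \<subseteq> uedges (G \<restriction> ball x R)"
    by blast
  have "card (uedges (G \<restriction> J)) + card (ball x R - J) =
      card (uedges (G \<restriction> J) \<union> parent_edge x ` (ball x R - J))"
    using card_image[OF inj]
    by (simp add: card_Un_disjoint[OF _ _ disj] finite_uedges_induce finite_ball)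
  also have "\<dots> \<le> card (uedges (G \<restriction> ball x R))" by (rule card_mono[OF finite_uedges_induce sub])
  also have "\<dots> \<le> card (ball x R)"
    using bicycle_free_ball[OF x] by (simp add: bicycle_free_induce_iff)
  also have "\<dots> = card J + card (ball x R - J)"
    using card_Diff_subset[OF finite_subset[OF J finite_ball] J] card_mono[OF finite_ball J] by simp
  finally show ?thesis by (simp add: bicycle_free_induce_iff)
qed

lemma card_uedges_induce_le:
  fixes \<delta> :: real
  assumes R: "0 < R" and \<delta>: "0 \<le> \<delta>"
    and "X \<subseteq> verts G" "real (card X) \<le> (1 + \<delta>) ^ R"
  shows "real (card (uedges (G \<restriction> X))) \<le> (1 + \<delta>) * real (card X)"
  using assms(3,4)
proof (induction "card X" arbitrary: X rule: less_induct)
  case less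
  have finX: "finite X" using less.prems(1) finite_verts by (rule finite_subset)
  show ?case
  proof (cases "X = {}")
    case True
    then show ?thesis by (simp add: uedges_induce)
  next
    case False
    then obtain x where x: "x \<in> X" by blast
    define B where "B i = X \<inter> ball x i" for i
    have xB: "x \<in> B i" for i using x less.prems(1) center_in_ball by (auto simp: B_def)
    obtain i where i: "i < R" "real (card (B (Suc i))) \<le> (1 + \<delta>) * real (card (B i))"
      using ex_slow_layer[OF R \<delta> less.prems x] by (auto simp: B_def)
    have card_X: "card X = card (B i) + card (X - ball x i)"
      unfolding B_def by (rule card_Int_Diff[OF finX])
    moreover have "0 < card (B i)" using xB finX by (auto simp: card_gt_0_iff B_def)
    ultimately have outside:
      "real (card (uedges (G \<restriction> (X - ball x i)))) \<le> (1 + \<delta>) * real (card (X - ball x i))"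
      using less.prems by (intro less.hyps) auto
    have "card (uedges (G \<restriction> X)) \<le> card (uedges (G \<restriction> B (Suc i)) \<union> uedges (G \<restriction> (X - ball x i)))"
      using uedges_induce_subset_layers[of X x i]
      by (intro card_mono) (simp_all add: finite_uedges_induce B_def)
    also have "\<dots> \<le> card (uedges (G \<restriction> B (Suc i))) + card (uedges (G \<restriction> (X - ball x i)))"
      by (rule card_Un_le)
    also have "card (uedges (G \<restriction> B (Suc i))) \<le> card (B (Suc i))"
      using bicycle_free_subset_ball[of x "B (Suc i)"] xB ball_mono[of "Suc i" R x] i(1)
      by (auto simp: bicycle_free_induce_iff B_def)
    finally show ?thesis using i(2) outside by (simp add: card_X distrib_left)
  qed
qed

lemma card_non_parent_edges_le_1:
  assumes "y \<in> verts G"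
  shows "card (uedges (G \<restriction> ball y R) - parent_edge y ` (ball y R - {y})) \<le> 1"
proof -
  have "card (parent_edge y ` (ball y R - {y})) = card (ball y R) - 1"
    using center_in_ball[OF assms] by (simp add: card_image[OF inj_on_parent_edge])
  moreover have "parent_edge y ` (ball y R - {y}) \<subseteq> uedges (G \<restriction> ball y R)"
    using parent_edge_in_uedges by blast
  moreover have "card (uedges (G \<restriction> ball y R)) \<le> card (ball y R)"
    using bicycle_free_ball[OF assms] by (simp add: bicycle_free_induce_iff)
  ultimately show ?thesis by (simp add: card_Diff_subset finite_ball)
qed

lemma ball_is_tree_plus_edge:
  assumes "y \<in> verts G"
  shows "\<exists>a b. \<forall>u\<in>ball y R. \<forall>v\<in>ball y R. u \<rightarrow>\<^bsub>G\<^esub> v \<longrightarrow>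
    add_edge (forest_adj (parent_in_ball y R)) {a, b} u v"
proof -
  let ?D = "uedges (G \<restriction> ball y R) - parent_edge y ` (ball y R - {y})"
  have "\<exists>a b. ?D \<subseteq> {{a, b}}"
  proof (cases "?D = {}")
    case False
    then obtain e where e: "e \<in> ?D" by blast
    then obtain a b where "e = {a, b}" by (auto simp: uedges_induce)
    moreover have "f = e" if "f \<in> ?D" for f
      using card_non_parent_edges_le_1[OF assms] e that
      by (simp only: One_nat_def card_le_Suc0_iff_eq finite_Diff finite_uedges_induce)
    ultimately show ?thesis by blast
  qed auto
  then obtain a b where ab: "?D \<subseteq> {{a, b}}" by blast
  show ?thesis
  proof (intro exI ballI impI)
    fix u v assume uv: "u \<in> ball y R" "v \<in> ball y R" "u \<rightarrow>\<^bsub>G\<^esub> v"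
    then have "{u, v} \<in> uedges (G \<restriction> ball y R)" by (simp add: doubleton_in_uedges_induce)
    then have "{u, v} = {a, b} \<or> (\<exists>w \<in> ball y R - {y}. {u, v} = parent_edge y w)" using ab by blast
    then show "add_edge (forest_adj (parent_in_ball y R)) {a, b} u v"
      by (auto simp: add_edge_def forest_adj_def parent_in_ball_def parent_edge_def
          doubleton_eq_iff)
  qed
qed

lemma card_nb_walks_le:
  assumes y: "y \<in> verts G" and m: "m \<le> R"
  shows "finite (nb_walks (\<lambda>u v. u \<rightarrow>\<^bsub>G\<^esub> v) m x y)"
    "card (nb_walks (\<lambda>u v. u \<rightarrow>\<^bsub>G\<^esub> v) m x y) \<le> 2 * Suc m"
proof -
  interpret rooted_forest "parent_in_ball y R" "distance y" by (rule rooted_forest_parent_in_ball)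
  obtain a b where ab: "\<forall>u\<in>ball y R. \<forall>v\<in>ball y R. u \<rightarrow>\<^bsub>G\<^esub> v \<longrightarrow>
    add_edge (forest_adj (parent_in_ball y R)) {a, b} u v"
    using ball_is_tree_plus_edge[OF y] by blast
  have sub: "nb_walks (\<lambda>u v. u \<rightarrow>\<^bsub>G\<^esub> v) m x y \<subseteq>
    nb_walks (add_edge (forest_adj (parent_in_ball y R)) {a, b}) m x y"
  proof
    fix p assume p: "p \<in> nb_walks (\<lambda>u v. u \<rightarrow>\<^bsub>G\<^esub> v) m x y"
    then have "set p \<subseteq> ball y R"
      using walk_subset_ball_last[of p] ball_mono[OF m] y by (auto simp: nb_walks_def nb_walk_def)
    then have "successively (add_edge (forest_adj (parent_in_ball y R)) {a, b}) p"
      using p ab by (auto simp: nb_walks_def nb_walk_def elim!: successively_mono)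
    then show "p \<in> nb_walks (add_edge (forest_adj (parent_in_ball y R)) {a, b}) m x y"
      using p by (simp add: nb_walks_def nb_walk_def)
  qed
  note bounds = card_nb_walks_add_edge_le[of a b m x y]
  show "finite (nb_walks (\<lambda>u v. u \<rightarrow>\<^bsub>G\<^esub> v) m x y)" using sub bounds(1) by (rule finite_subset)
  show "card (nb_walks (\<lambda>u v. u \<rightarrow>\<^bsub>G\<^esub> v) m x y) \<le> 2 * Suc m"
    using card_mono[OF bounds(1) sub] bounds(2) by (rule order_trans)
qed

end

section \<open>Patterns of new and old steps\<close>

lemma card_eq_sum_fibres: "finite A \<Longrightarrow> card A = (\<Sum>y\<in>f ` A. card {x \<in> A. f x = y})"
  using sum.image_gen[of A "\<lambda>_. 1 :: nat" f] by simp

lemma card_small_subsets_le: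
  assumes "finite A"
  shows "card {X. X \<subseteq> A \<and> card X \<le> q} \<le> Suc (card A) ^ q"
proof -
  let ?L = "{xs. set xs \<subseteq> insert None (Some ` A) \<and> length xs = q}"
  have fin: "finite ?L" using assms by (intro finite_lists_length_eq) simp
  have "{X. X \<subseteq> A \<and> card X \<le> q} \<subseteq> (\<lambda>xs. {x. Some x \<in> set xs}) ` ?L"
  proof
    fix X assume "X \<in> {X. X \<subseteq> A \<and> card X \<le> q}"
    then have X: "X \<subseteq> A" "card X \<le> q" by auto
    then obtain ys where ys: "set ys = X" "length ys = card X"
      using assms finite_subset finite_distinct_list distinct_card by metis
    have "map Some ys @ replicate (q - card X) None \<in> ?L" using X ys by auto
    moreover have "X = {x. Some x \<in> set (map Some ys @ replicate (q - card X) None)}"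
      using ys by auto
    ultimately show "X \<in> (\<lambda>xs. {x. Some x \<in> set xs}) ` ?L" by blast
  qed
  then have "card {X. X \<subseteq> A \<and> card X \<le> q} \<le> card ?L" using fin by (rule surj_card_le[rotated])
  also have "\<dots> = Suc (card A) ^ q"
    using assms by (simp add: card_lists_length_eq card_image)
  finally show ?thesis .
qed

lemma card_multiples_le:
  assumes "0 < (R::nat)"
  shows "card {j. j < n \<and> R dvd j} \<le> Suc (n div R)"
proof -
  have "{j. j < n \<and> R dvd j} \<subseteq> (\<lambda>i. R * i) ` {..n div R}"
  proof
    fix j assume "j \<in> {j. j < n \<and> R dvd j}"
    then obtain i where "j = R * i" "j < n" by auto
    then show "j \<in> (\<lambda>i. R * i) ` {..n div R}"
      using assms
      by (auto intro!: image_eqI[of _ _ i] simp: less_eq_div_iff_mult_less_eq mult.commute)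
  qed
  then have "card {j. j < n \<and> R dvd j} \<le> card {..n div R}"
    using finite_atMost by (rule surj_card_le[rotated])
  then show ?thesis by simp
qed

definition exits :: "nat \<Rightarrow> nat set \<Rightarrow> nat set" where
  "exits n T = {t. Suc t < n \<and> t \<in> T \<and> Suc t \<notin> T}"

lemma exits_subset_lessThan: "exits n T \<subseteq> {..<n}"
  by (auto simp: exits_def)

lemma finite_exits: "finite (exits n T)"
  using exits_subset_lessThan finite_lessThan by (rule finite_subset)

lemma exits_Suc_Suc:
  "exits (Suc (Suc n)) T =
    (if n \<in> T \<and> Suc n \<notin> T then insert n (exits (Suc n) T) else exits (Suc n) T)"
  by (auto simp: exits_def less_Suc_eq)

lemma card_exits_Compl_le:
  assumes "0 \<in> T"
  shows "card (exits n (- T)) \<le> card (exits n T)"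
proof -
  have "card (exits (Suc m) (- T)) + (if m \<in> T then 0 else 1) = card (exits (Suc m) T)" for m
  proof (induction m)
    case 0
    then show ?case using assms by (simp add: exits_def)
  next
    case (Suc m)
    have "m \<notin> exits (Suc m) U" for U by (simp add: exits_def)
    then show ?case using Suc by (simp add: exits_Suc_Suc finite_exits split: if_splits)
  qed
  then have "card (exits (Suc m) (- T)) \<le> card (exits (Suc m) T)" for m
    using le_add1 by metis
  then show ?thesis by (cases n) (simp_all add: exits_def)
qed

lemma eq_if_exits_eq:
  assumes "T \<subseteq> {..<n}" "T' \<subseteq> {..<n}" "0 \<in> T" "0 \<in> T'"
    and "exits n T = exits n T'" "exits n (- T) = exits n (- T')"
  shows "T = T'"
proof -
  have "s < n \<Longrightarrow> s \<in> T \<longleftrightarrow> s \<in> T'" for s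
  proof (induction s)
    case (Suc s)
    have "s \<in> exits n T \<longleftrightarrow> s \<in> exits n T'" "s \<in> exits n (- T) \<longleftrightarrow> s \<in> exits n (- T')"
      using assms(5,6) by simp_all
    then show ?case using Suc by (auto simp: exits_def)
  qed (use assms in simp)
  then show ?thesis using assms(1,2) by blast
qed

lemma card_patterns_le:
  assumes "\<And>T. T \<in> \<T> \<Longrightarrow> T \<subseteq> {..<n} \<and> 0 \<in> T \<and> card (exits n T) \<le> q"
  shows "card \<T> \<le> Suc n ^ (2 * q)"
proof -
  let ?X = "{X. X \<subseteq> {..<n} \<and> card X \<le> q}"
  let ?f = "\<lambda>T. (exits n T, exits n (- T))"
  have inj: "inj_on ?f \<T>"
  proof (rule inj_onI)
    fix T T' assume "T \<in> \<T>" "T' \<in> \<T>" "?f T = ?f T'"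
    then show "T = T'" using assms[of T] assms[of T'] by (intro eq_if_exits_eq[of T n T']) simp_all
  qed
  have sub: "?f ` \<T> \<subseteq> ?X \<times> ?X"
  proof
    fix z assume "z \<in> ?f ` \<T>"
    then obtain T where T: "T \<in> \<T>" "z = ?f T" by blast
    then have "card (exits n (- T)) \<le> q" using assms[of T] card_exits_Compl_le[of T n] by simp
    then show "z \<in> ?X \<times> ?X" using T assms[of T] exits_subset_lessThan by simp
  qed
  have "card \<T> \<le> card (?X \<times> ?X)" using inj sub by (rule card_inj_on_le) simp
  also have "\<dots> = card ?X * card ?X" by (rule card_cartesian_product)
  also have "\<dots> \<le> Suc n ^ q * Suc n ^ q"
    using card_small_subsets_le[of "{..<n}" q] by (intro mult_le_mono) simp_all
  finally show ?thesis by (simp add: mult_2 power_add)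
qed

definition step_edge :: "'a list \<Rightarrow> nat \<Rightarrow> 'a set" where
  "step_edge xs i = {xs ! i, xs ! Suc i}"

definition walk_edges :: "'a list \<Rightarrow> 'a set set" where
  "walk_edges xs = step_edge xs ` {s. Suc s < length xs}"

definition new_steps :: "'a list \<Rightarrow> nat set" where
  "new_steps xs = {s. Suc s < length xs \<and> (\<forall>i<s. step_edge xs i \<noteq> step_edge xs s)}"

definition fresh_steps :: "'a list \<Rightarrow> nat set" where
  "fresh_steps xs = {s. Suc s < length xs \<and> (\<forall>i\<le>s. xs ! i \<noteq> xs ! Suc s)}"

lemma finite_new_steps: "finite (new_steps xs)"
  by (rule finite_subset[of _ "{..<length xs}"]) (auto simp: new_steps_def)

lemma fresh_steps_subset_new_steps: "fresh_steps xs \<subseteq> new_steps xs"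
  by (auto simp: fresh_steps_def new_steps_def step_edge_def doubleton_eq_iff)

lemma finite_fresh_steps: "finite (fresh_steps xs)"
  using fresh_steps_subset_new_steps finite_new_steps by (rule finite_subset)

lemma ex_new_step_same_edge:
  assumes "Suc i < length xs"
  shows "\<exists>j\<in>new_steps xs. j \<le> i \<and> step_edge xs j = step_edge xs i"
  using assms
proof (induction i rule: less_induct)
  case (less i)
  show ?case
  proof (cases "i \<in> new_steps xs")
    case False
    then obtain j where "j < i" "step_edge xs j = step_edge xs i"
      using less.prems by (auto simp: new_steps_def)
    moreover then obtain j' where "j' \<in> new_steps xs" "j' \<le> j" "step_edge xs j' = step_edge xs j"
      using less.IH[of j] less.prems by auto
    ultimately show ?thesis by (intro bexI[of _ j']) auto
  qed auto
qed

lemma card_new_steps: "card (new_steps xs) = card (walk_edges xs)"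
proof -
  have "walk_edges xs = step_edge xs ` new_steps xs"
  proof
    show "walk_edges xs \<subseteq> step_edge xs ` new_steps xs"
    proof
      fix e assume "e \<in> walk_edges xs"
      then obtain i where "Suc i < length xs" "e = step_edge xs i" by (auto simp: walk_edges_def)
      then show "e \<in> step_edge xs ` new_steps xs" using ex_new_step_same_edge by blast
    qed
  qed (auto simp: new_steps_def walk_edges_def)
  moreover have "inj_on (step_edge xs) (new_steps xs)"
    by (rule inj_onI) (metis (mono_tags, lifting) linorder_neqE_nat mem_Collect_eq new_steps_def)
  ultimately show ?thesis by (simp add: card_image)
qed

lemma card_set_le_fresh_steps: "card (set xs) \<le> Suc (card (fresh_steps xs))"
proof -
  have "set xs \<subseteq> insert (xs ! 0) ((\<lambda>s. xs ! Suc s) ` fresh_steps xs)"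
  proof
    fix v assume v: "v \<in> set xs"
    define i where "i = (LEAST i. i < length xs \<and> xs ! i = v)"
    have i: "i < length xs" "xs ! i = v"
      using LeastI_ex[of "\<lambda>i. i < length xs \<and> xs ! i = v"] v unfolding i_def in_set_conv_nth by auto
    have least: "xs ! j \<noteq> v" if "j < i" for j
      using not_less_Least[of j "\<lambda>i. i < length xs \<and> xs ! i = v"] that i unfolding i_def by auto
    show "v \<in> insert (xs ! 0) ((\<lambda>s. xs ! Suc s) ` fresh_steps xs)"
    proof (cases i)
      case (Suc s)
      then have "s \<in> fresh_steps xs" using i least by (auto simp: fresh_steps_def)
      then show ?thesis using i Suc by auto
    qed (use i in auto)
  qed
  then have "card (set xs) \<le> card (insert (xs ! 0) ((\<lambda>s. xs ! Suc s) ` fresh_steps xs))"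
    using finite_fresh_steps by (intro card_mono) auto
  also have "\<dots> \<le> Suc (card (fresh_steps xs))"
    using finite_fresh_steps[of xs] card_image_le[OF finite_fresh_steps, of "\<lambda>s. xs ! Suc s" xs]
    by (simp add: card_insert_if)
  finally show ?thesis .
qed

lemma old_step_after_fresh_step_backtracks:
  assumes "t \<in> fresh_steps xs" "Suc t \<notin> new_steps xs" "Suc (Suc t) < length xs"
  shows "xs ! Suc (Suc t) = xs ! t"
proof -
  have fresh: "xs ! i \<noteq> xs ! Suc t" if "i \<le> t" for i
    using assms(1) that by (auto simp: fresh_steps_def)
  obtain j where j: "j \<le> t" "step_edge xs j = step_edge xs (Suc t)"
    using assms(2,3) by (auto simp: new_steps_def less_Suc_eq_le)
  then have "xs ! Suc t \<in> {xs ! j, xs ! Suc j}" by (auto simp: step_edge_def)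
  then have "xs ! Suc t = xs ! Suc j" using fresh[of j] j(1) by auto
  then have "j = t" using fresh[of "Suc j"] j(1) by (cases "j = t") auto
  then show ?thesis using j(2) fresh[of t] by (auto simp: step_edge_def doubleton_eq_iff)
qed

definition prefixes :: "'a list set \<Rightarrow> nat \<Rightarrow> 'a list set" where
  "prefixes S t = take (Suc t) ` S"

lemma card_prefixes_le:
  assumes "finite S" "s \<le> t"
    and ext: "\<And>xs. xs \<in> S \<Longrightarrow> drop (Suc s) (take (Suc t) xs) \<in> E (take (Suc s) xs)"
    and fin_E: "\<And>ys. ys \<in> prefixes S s \<Longrightarrow> finite (E ys)"
    and card_E: "\<And>ys. ys \<in> prefixes S s \<Longrightarrow> card (E ys) \<le> c"
  shows "card (prefixes S t) \<le> c * card (prefixes S s)"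
proof -
  have fin: "finite (prefixes S s)" using assms(1) by (simp add: prefixes_def)
  have "prefixes S t \<subseteq> (\<lambda>(ys, zs). ys @ zs) ` (SIGMA ys:prefixes S s. E ys)"
  proof
    fix zs assume "zs \<in> prefixes S t"
    then obtain xs where xs: "xs \<in> S" "zs = take (Suc t) xs" by (auto simp: prefixes_def)
    have "take (Suc s) (take (Suc t) xs) = take (Suc s) xs" using \<open>s \<le> t\<close> by simp
    then have "zs = take (Suc s) xs @ drop (Suc s) (take (Suc t) xs)"
      using append_take_drop_id[of "Suc s" "take (Suc t) xs"] xs(2) by simp
    then show "zs \<in> (\<lambda>(ys, zs). ys @ zs) ` (SIGMA ys:prefixes S s. E ys)"
      using xs(1) ext[OF xs(1)] by (force simp: prefixes_def)
  qed
  then have "card (prefixes S t) \<le> card (SIGMA ys:prefixes S s. E ys)"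
    using fin fin_E by (intro surj_card_le) auto
  also have "\<dots> = (\<Sum>ys\<in>prefixes S s. card (E ys))" using fin fin_E by (simp add: card_SigmaI)
  also have "\<dots> \<le> card (prefixes S s) * c"
    using card_E sum_bounded_above[of _ "\<lambda>ys. card (E ys)" c] by simp
  finally show ?thesis by (simp add: mult.commute)
qed

section \<open>Counting hikes\<close>

locale hike_graph = bicycle_free_graph +
  fixes d k :: nat
  assumes out_degree_le: "v \<in> verts G \<Longrightarrow> out_degree G v \<le> d"
    and two_le_d: "2 \<le> d" and R_pos: "0 < R"
begin

definition vertex_hikes :: "'a list set" where
  "vertex_hikes = {xs. length xs = Suc (2 * k) \<and> set xs \<subseteq> verts G \<and> last xs = hd xs \<and>
     successively (\<lambda>u v. u \<rightarrow>\<^bsub>G\<^esub> v) xs \<and>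
     (\<forall>i. Suc (Suc i) < length xs \<and> Suc i \<noteq> k \<longrightarrow> xs ! i \<noteq> xs ! Suc (Suc i))}"

lemma length_vertex_hike: "xs \<in> vertex_hikes \<Longrightarrow> length xs = Suc (2 * k)"
  by (simp add: vertex_hikes_def)

lemma vertex_hike_ne: "xs \<in> vertex_hikes \<Longrightarrow> xs \<noteq> []"
  by (auto simp: vertex_hikes_def)

lemma set_vertex_hike: "xs \<in> vertex_hikes \<Longrightarrow> set xs \<subseteq> verts G"
  by (simp add: vertex_hikes_def)

lemma last_vertex_hike: "xs \<in> vertex_hikes \<Longrightarrow> last xs = hd xs"
  by (simp add: vertex_hikes_def)

lemma vertex_hike_adj: "xs \<in> vertex_hikes \<Longrightarrow> Suc i \<le> 2 * k \<Longrightarrow> xs ! i \<rightarrow>\<^bsub>G\<^esub> xs ! Suc i"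
  by (simp add: vertex_hikes_def successively_conv_nth)

lemma vertex_hike_no_backtrack:
  "xs \<in> vertex_hikes \<Longrightarrow> Suc (Suc i) \<le> 2 * k \<Longrightarrow> Suc i \<noteq> k \<Longrightarrow> xs ! i \<noteq> xs ! Suc (Suc i)"
  by (simp add: vertex_hikes_def)

lemma finite_vertex_hikes: "finite vertex_hikes"
  by (rule finite_subset[OF _ finite_lists_length_eq[OF finite_verts, of "Suc (2 * k)"]])
    (auto simp: vertex_hikes_def)

lemma finite_subset_vertex_hikes: "S \<subseteq> vertex_hikes \<Longrightarrow> finite S"
  using finite_vertex_hikes finite_subset by blast

lemma card_neighbours_le: "card {v. u \<rightarrow>\<^bsub>G\<^esub> v} \<le> d"
proof (cases "u \<in> verts G")
  case True
  have "{v. u \<rightarrow>\<^bsub>G\<^esub> v} \<subseteq> head G ` out_arcs G u" by (auto simp: arcs_ends_conv)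
  then have "card {v. u \<rightarrow>\<^bsub>G\<^esub> v} \<le> card (out_arcs G u)" by (intro surj_card_le) auto
  then show ?thesis using out_degree_le[OF True] by (simp add: out_degree_def)
next
  case False
  then have "{v. u \<rightarrow>\<^bsub>G\<^esub> v} = {}" using adj_in_verts by blast
  then show ?thesis by simp
qed

lemma finite_neighbours: "finite {v. u \<rightarrow>\<^bsub>G\<^esub> v}"
  using finite_verts by (rule finite_subset[rotated]) (auto dest: adj_in_verts)

definition step_factor :: "nat \<Rightarrow> nat" where
  "step_factor t = (if t = 0 \<or> t = k then d else d - 1)"

lemma prefixes_full: "S \<subseteq> vertex_hikes \<Longrightarrow> prefixes S (2 * k) = S"
  using length_vertex_hike by (force simp: prefixes_def image_iff)

lemma card_prefixes_0_le:
  assumes "S \<subseteq> vertex_hikes"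
  shows "card (prefixes S 0) \<le> card (verts G)"
proof -
  have "prefixes S 0 \<subseteq> (\<lambda>v. [v]) ` verts G"
  proof
    fix ys assume "ys \<in> prefixes S 0"
    then obtain xs where xs: "xs \<in> vertex_hikes" "ys = take (Suc 0) xs"
      using assms by (auto simp: prefixes_def)
    then show "ys \<in> (\<lambda>v. [v]) ` verts G"
      using set_vertex_hike[OF xs(1)] vertex_hike_ne[OF xs(1)] by (cases xs) auto
  qed
  then show ?thesis using finite_verts by (intro surj_card_le)
qed

definition continuations :: "nat \<Rightarrow> 'a list \<Rightarrow> 'a set" where
  "continuations t ys = {v. ys ! t \<rightarrow>\<^bsub>G\<^esub> v} - (if t = 0 \<or> t = k then {} else {ys ! (t - 1)})"

lemma nth_Suc_in_continuations:
  assumes "xs \<in> vertex_hikes" "t < 2 * k"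
  shows "xs ! Suc t \<in> continuations t (take (Suc t) xs)"
  using vertex_hike_adj[OF assms(1), of t] vertex_hike_no_backtrack[OF assms(1), of "t - 1"]
    assms(2)
  by (auto simp: continuations_def)

lemma card_continuations_le:
  assumes xs: "xs \<in> vertex_hikes" and "t < 2 * k"
  shows "card (continuations t (take (Suc t) xs)) \<le> step_factor t"
proof (cases "t = 0 \<or> t = k")
  case True
  then show ?thesis using card_neighbours_le by (auto simp: continuations_def step_factor_def)
next
  case False
  then have "xs ! (t - 1) \<rightarrow>\<^bsub>G\<^esub> xs ! t" using vertex_hike_adj[OF xs, of "t - 1"] assms(2) by simp
  then have "xs ! (t - 1) \<in> {v. xs ! t \<rightarrow>\<^bsub>G\<^esub> v}" using adj_sym by simp
  then have "card (continuations t (take (Suc t) xs)) = card {v. xs ! t \<rightarrow>\<^bsub>G\<^esub> v} - 1"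
    using False by (simp add: continuations_def)
  then show ?thesis using card_neighbours_le[of "xs ! t"] False by (simp add: step_factor_def)
qed

lemma card_prefixes_Suc_le:
  assumes S: "S \<subseteq> vertex_hikes" and t: "t < 2 * k"
  shows "card (prefixes S (Suc t)) \<le> step_factor t * card (prefixes S t)"
proof (rule card_prefixes_le[where E = "\<lambda>ys. (\<lambda>v. [v]) ` continuations t ys"])
  show "finite S" using finite_subset_vertex_hikes[OF S] .
next
  fix xs assume "xs \<in> S"
  then have xs: "xs \<in> vertex_hikes" using S by blast
  then have "drop (Suc t) (take (Suc (Suc t)) xs) = [xs ! Suc t]"
    using length_vertex_hike[OF xs] t by (simp add: take_Suc_conv_app_nth)
  then show "drop (Suc t) (take (Suc (Suc t)) xs) \<in> (\<lambda>v. [v]) ` continuations t (take (Suc t) xs)"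
    using nth_Suc_in_continuations[OF xs t] by simp
next
  fix ys assume "ys \<in> prefixes S t"
  then obtain xs where xs: "xs \<in> vertex_hikes" "ys = take (Suc t) xs"
    using S by (auto simp: prefixes_def)
  show "finite ((\<lambda>v. [v]) ` continuations t ys)"
    by (simp add: continuations_def finite_neighbours)
  show "card ((\<lambda>v. [v]) ` continuations t ys) \<le> step_factor t"
    using card_continuations_le[OF xs(1) t] xs(2) by (simp add: card_image inj_on_def)
qed simp

lemma hike_segment_in_nb_walks:
  assumes xs: "xs \<in> vertex_hikes" and st: "s \<le> t" "t \<le> 2 * k"
    and no_turn: "\<And>j. s < j \<Longrightarrow> j < t \<Longrightarrow> j \<noteq> k"
  shows "drop s (take (Suc t) xs) \<in> nb_walks (\<lambda>u v. u \<rightarrow>\<^bsub>G\<^esub> v) (t - s) (xs ! s) (xs ! t)"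
proof -
  let ?p = "drop s (take (Suc t) xs)"
  have len: "length ?p = Suc (t - s)" using length_vertex_hike[OF xs] st by simp
  then have ne: "?p \<noteq> []" by auto
  have nth: "?p ! i = xs ! (s + i)" if "i \<le> t - s" for i
    using that st length_vertex_hike[OF xs] by simp
  have "successively (\<lambda>u v. u \<rightarrow>\<^bsub>G\<^esub> v) ?p"
    unfolding successively_conv_nth using len nth vertex_hike_adj[OF xs] st by auto
  moreover have "nonbacktracking ?p"
    unfolding nonbacktracking_def
  proof (intro allI impI)
    fix i assume i: "Suc (Suc i) < length ?p"
    then have "Suc (s + i) \<noteq> k" using no_turn[of "Suc (s + i)"] len by linarith
    then show "?p ! i \<noteq> ?p ! Suc (Suc i)"
      using vertex_hike_no_backtrack[OF xs, of "s + i"] nth[of i] nth[of "Suc (Suc i)"]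
        i len st
      by simp
  qed
  moreover have "hd ?p = xs ! s" using ne nth[of 0] by (simp add: hd_conv_nth)
  moreover have "last ?p = xs ! t" using ne nth[of "t - s"] len st by (simp add: last_conv_nth)
  ultimately show ?thesis using len ne by (simp add: nb_walks_def nb_walk_def)
qed

lemma card_prefixes_segment_le:
  assumes S: "S \<subseteq> vertex_hikes" and st: "s \<le> t" "t \<le> 2 * k" "t - s \<le> R"
    and no_turn: "\<And>j. s < j \<Longrightarrow> j < t \<Longrightarrow> j \<noteq> k"
    and Y: "\<And>xs. xs \<in> S \<Longrightarrow> xs ! t \<in> Y (take (Suc s) xs)"
    and Y_verts: "\<And>ys. ys \<in> prefixes S s \<Longrightarrow> Y ys \<subseteq> verts G"
    and card_Y: "\<And>ys. ys \<in> prefixes S s \<Longrightarrow> card (Y ys) \<le> c"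
  shows "card (prefixes S t) \<le> c * (2 * Suc (t - s)) * card (prefixes S s)"
proof -
  define P where "P ys = (\<Union>y\<in>Y ys. nb_walks (\<lambda>u v. u \<rightarrow>\<^bsub>G\<^esub> v) (t - s) (ys ! s) y)" for ys
  have fin_Y: "finite (Y ys)" if "ys \<in> prefixes S s" for ys
    using Y_verts[OF that] finite_verts by (rule finite_subset)
  have fin_P: "finite (P ys)" if "ys \<in> prefixes S s" for ys
    unfolding P_def using fin_Y[OF that] Y_verts[OF that] card_nb_walks_le(1) st(3) by blast
  have card_P: "card (P ys) \<le> c * (2 * Suc (t - s))" if ys: "ys \<in> prefixes S s" for ys
  proof -
    have "card (P ys) \<le> (\<Sum>y\<in>Y ys. card (nb_walks (\<lambda>u v. u \<rightarrow>\<^bsub>G\<^esub> v) (t - s) (ys ! s) y))"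
      unfolding P_def by (rule card_UN_le[OF fin_Y[OF ys]])
    also have "\<dots> \<le> of_nat (card (Y ys)) * (2 * Suc (t - s))"
      using card_nb_walks_le(2)[OF _ st(3)] Y_verts[OF ys] by (intro sum_bounded_above) blast
    also have "\<dots> = card (Y ys) * (2 * Suc (t - s))" by (simp only: of_nat_id)
    also have "\<dots> \<le> c * (2 * Suc (t - s))" using card_Y[OF ys] by (rule mult_le_mono1)
    finally show ?thesis .
  qed
  show ?thesis
  proof (rule card_prefixes_le[where E = "\<lambda>ys. tl ` P ys"])
    fix xs assume xs: "xs \<in> S"
    have "drop s (take (Suc t) xs) \<in> P (take (Suc s) xs)"
      using hike_segment_in_nb_walks[of xs s t] xs S st no_turn Y[OF xs] by (auto simp: P_def)
    then have "tl (drop s (take (Suc t) xs)) \<in> tl ` P (take (Suc s) xs)" by (rule imageI)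
    then show "drop (Suc s) (take (Suc t) xs) \<in> tl ` P (take (Suc s) xs)"
      by (simp only: drop_Suc tl_drop)
  next
    fix ys assume ys: "ys \<in> prefixes S s"
    show "finite (tl ` P ys)" using fin_P[OF ys] by simp
    show "card (tl ` P ys) \<le> c * (2 * Suc (t - s))"
      using card_image_le[OF fin_P[OF ys]] card_P[OF ys] by (rule order_trans)
  qed (use finite_subset_vertex_hikes[OF S] st in auto)
qed

lemma card_prefixes_le_prod_step_factor:
  assumes "S \<subseteq> vertex_hikes" "t \<le> 2 * k"
  shows "card (prefixes S t) \<le> card (verts G) * (\<Prod>j<t. step_factor j)"
  using assms(2)
proof (induction t)
  case 0
  then show ?case using card_prefixes_0_le[OF assms(1)] by simp
next
  case (Suc t)
  have "card (prefixes S (Suc t)) \<le> step_factor t * card (prefixes S t)"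
    using card_prefixes_Suc_le[OF assms(1)] Suc.prems by simp
  also have "\<dots> \<le> step_factor t * (card (verts G) * (\<Prod>j<t. step_factor j))"
    using Suc by (intro mult_le_mono2) simp
  finally show ?case by (simp add: ac_simps)
qed

lemma prod_step_factor_le:
  assumes "finite A"
  shows "(\<Prod>j\<in>A. step_factor j) \<le> d ^ card (A \<inter> {0, k}) * (d - 1) ^ card A"
proof -
  have "(\<Prod>j\<in>A. step_factor j) \<le> (\<Prod>j\<in>A. (if j \<in> {0, k} then d else 1) * (d - 1))"
    using two_le_d by (intro prod_mono) (auto simp: step_factor_def)
  also have "\<dots> = (\<Prod>j\<in>A. if j \<in> {0, k} then d else 1) * (d - 1) ^ card A"
    by (simp only: prod.distrib prod_constant)
  also have "(\<Prod>j\<in>A. if j \<in> {0, k} then d else 1) = d ^ card (A \<inter> {0, k})"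
    by (simp only: prod.inter_restrict[OF assms, symmetric] prod_constant)
  finally show ?thesis .
qed

lemma card_vertex_hikes_le:
  assumes "k \<le> R"
  shows "card vertex_hikes \<le> 2 * Suc k * (card (verts G) * (d * (d - 1) ^ k))"
proof -
  have "card (prefixes vertex_hikes (2 * k)) \<le>
      1 * (2 * Suc (2 * k - k)) * card (prefixes vertex_hikes k)"
  proof (rule card_prefixes_segment_le[where Y = "\<lambda>ys. {hd ys}"])
    fix xs assume xs: "xs \<in> vertex_hikes"
    then have "xs ! (2 * k) = hd xs"
      using length_vertex_hike[OF xs] last_vertex_hike[OF xs] vertex_hike_ne[OF xs]
      by (simp add: last_conv_nth)
    then show "xs ! (2 * k) \<in> {hd (take (Suc k) xs)}" by simp
  next
    fix ys assume "ys \<in> prefixes vertex_hikes k"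
    then obtain xs where xs: "xs \<in> vertex_hikes" "ys = take (Suc k) xs" by (auto simp: prefixes_def)
    then show "{hd ys} \<subseteq> verts G"
      using set_vertex_hike[OF xs(1)] vertex_hike_ne[OF xs(1)] hd_in_set[of xs] by auto
  qed (use assms in auto)
  also have "\<dots> = 2 * Suc k * card (prefixes vertex_hikes k)" by simp
  also have "\<dots> \<le> 2 * Suc k * (card (verts G) * (d * (d - 1) ^ k))"
  proof (rule mult_le_mono2)
    have "card (prefixes vertex_hikes k) \<le> card (verts G) * (\<Prod>j<k. step_factor j)"
      by (rule card_prefixes_le_prod_step_factor) auto
    also have "(\<Prod>j<k. step_factor j) \<le> d ^ card ({..<k} \<inter> {0, k}) * (d - 1) ^ k"
      using prod_step_factor_le[of "{..<k}"] by simp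
    also have "d ^ card ({..<k} \<inter> {0, k}) \<le> d ^ card {0 :: nat}"
      using two_le_d by (intro power_increasing card_mono) auto
    finally show "card (prefixes vertex_hikes k) \<le> card (verts G) * (d * (d - 1) ^ k)" by simp
  qed
  finally show ?thesis by (simp only: prefixes_full[OF order_refl])
qed

lemma exits_new_steps_subset:
  assumes xs: "xs \<in> vertex_hikes"
  shows "exits (2 * k) (new_steps xs) \<subseteq> insert (k - 1) (new_steps xs - fresh_steps xs)"
proof
  fix t assume "t \<in> exits (2 * k) (new_steps xs)"
  then have t: "Suc t < 2 * k" "t \<in> new_steps xs" "Suc t \<notin> new_steps xs" by (auto simp: exits_def)
  then have "Suc (Suc t) < length xs" using length_vertex_hike[OF xs] by simp
  then have "xs ! Suc (Suc t) = xs ! t" if "t \<in> fresh_steps xs"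
    using old_step_after_fresh_step_backtracks[OF that t(3)] by simp
  then show "t \<in> insert (k - 1) (new_steps xs - fresh_steps xs)"
    using vertex_hike_no_backtrack[OF xs, of t] t by (cases "Suc t = k") auto
qed

lemma card_exits_new_steps_le:
  fixes \<delta> :: real
  assumes xs: "xs \<in> vertex_hikes" and few_edges: "card (walk_edges xs) \<le> k"
    and \<delta>: "0 \<le> \<delta>" "real (Suc k) \<le> (1 + \<delta>) ^ R"
  shows "real (card (exits (2 * k) (new_steps xs))) \<le> 2 + \<delta> * real (Suc k)"
proof -
  let ?N = "new_steps xs" and ?F = "fresh_steps xs"
  have card_F: "card ?F \<le> card ?N"
    using finite_new_steps fresh_steps_subset_new_steps by (rule card_mono)
  have card_V: "card (set xs) \<le> Suc (card ?F)" by (rule card_set_le_fresh_steps)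
  then have card_V_le: "card (set xs) \<le> Suc k" using card_F few_edges card_new_steps[of xs] by simp
  have "walk_edges xs \<subseteq> uedges (G \<restriction> set xs)"
    using length_vertex_hike[OF xs] vertex_hike_adj[OF xs]
    by (auto simp: walk_edges_def step_edge_def doubleton_in_uedges_induce)
  then have "real (card ?N) \<le> real (card (uedges (G \<restriction> set xs)))"
    using card_mono[OF finite_uedges_induce] by (simp add: card_new_steps)
  also have "\<dots> \<le> (1 + \<delta>) * real (card (set xs))"
    using card_V_le \<delta> by (intro card_uedges_induce_le[OF R_pos _ set_vertex_hike[OF xs]]) auto
  also have "\<dots> \<le> real (card (set xs)) + \<delta> * real (Suc k)"
    using card_V_le \<delta> by (simp add: distrib_right mult_left_mono del: of_nat_Suc)
  finally have excess: "real (card ?N) \<le> real (card (set xs)) + \<delta> * real (Suc k)" .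
  have "card (exits (2 * k) ?N) \<le> card (insert (k - 1) (?N - ?F))"
    using exits_new_steps_subset[OF xs] finite_new_steps by (intro card_mono) auto
  also have "\<dots> \<le> Suc (card (?N - ?F))" by (simp add: card_insert_if finite_new_steps)
  also have "card (?N - ?F) = card ?N - card ?F"
    using finite_fresh_steps fresh_steps_subset_new_steps by (rule card_Diff_subset)
  finally show ?thesis using card_F card_V excess by linarith
qed

text \<open>The cuts divide the old steps into segments of at most \<open>R\<close> steps that do not contain the
  turn, so that each segment is a non-backtracking walk inside one ball.\<close>

definition is_cut :: "nat set \<Rightarrow> nat \<Rightarrow> bool" where
  "is_cut T j \<longleftrightarrow> j = k \<or> R dvd j \<or> (0 < j \<and> j - 1 \<in> T)"

lemma ex_last_cut:
  assumes "0 < t"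
  shows "\<exists>s<t. is_cut T s \<and> t - s \<le> R \<and> (\<forall>j. s < j \<longrightarrow> j < t \<longrightarrow> \<not> is_cut T j)"
proof -
  let ?C = "{j. j < t \<and> is_cut T j}" and ?m = "R * ((t - 1) div R)"
  have "?m \<le> t - 1" by simp
  then have "?m < t" using assms by linarith
  then have m: "?m \<in> ?C" by (simp add: is_cut_def)
  have "t - 1 < ?m + R"
    using R_pos mult_div_mod_eq[of R "t - 1"] mod_less_divisor[of R "t - 1"] by linarith
  moreover have "?m \<le> Max ?C" using m by (intro Max_ge) auto
  ultimately have "t - Max ?C \<le> R" by linarith
  moreover have "Max ?C \<in> ?C" using m by (intro Max_in) auto
  moreover have "\<not> is_cut T j" if "Max ?C < j" "j < t" for j
  proof
    assume "is_cut T j"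
    then have "j \<le> Max ?C" using that by (intro Max_ge) auto
    then show False using that by simp
  qed
  ultimately show ?thesis by blast
qed

definition segment_factor :: nat where
  "segment_factor = Suc (2 * k) * (2 * Suc R)"

definition pattern_factor :: "nat set \<Rightarrow> nat \<Rightarrow> nat" where
  "pattern_factor T j =
     (if j \<in> T then step_factor j else if is_cut T j then segment_factor else 1)"

lemma old_step_target_in_prefix:
  assumes "Suc t < length xs" "s \<le> t" "\<And>j. s \<le> j \<Longrightarrow> j \<le> t \<Longrightarrow> j \<notin> new_steps xs"
  shows "xs ! Suc t \<in> set (take (Suc s) xs)"
proof -
  obtain j where j: "j \<in> new_steps xs" "j \<le> t" "step_edge xs j = step_edge xs t"
    using ex_new_step_same_edge[OF assms(1)] by blast
  then have "j < s" using assms(3)[of j] by (meson not_le)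
  have "xs ! i \<in> set (take (Suc s) xs)" if "i \<le> s" for i
    using that assms(1,2) nth_mem[of i "take (Suc s) xs"] by simp
  then have "step_edge xs j \<subseteq> set (take (Suc s) xs)" using \<open>j < s\<close> by (simp add: step_edge_def)
  moreover have "xs ! Suc t \<in> step_edge xs j" using j(3) by (simp add: step_edge_def)
  ultimately show ?thesis by blast
qed

lemma card_prefixes_old_segment_le:
  assumes S: "S \<subseteq> vertex_hikes" and T: "\<And>xs. xs \<in> S \<Longrightarrow> new_steps xs = T"
    and st: "s < t" "t \<le> 2 * k" "t - s \<le> R"
    and no_turn: "\<And>j. s < j \<Longrightarrow> j < t \<Longrightarrow> j \<noteq> k"
    and old: "\<And>j. s \<le> j \<Longrightarrow> j < t \<Longrightarrow> j \<notin> T"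
  shows "card (prefixes S t) \<le> segment_factor * card (prefixes S s)"
proof -
  have "card (prefixes S t) \<le> Suc (2 * k) * (2 * Suc (t - s)) * card (prefixes S s)"
  proof (rule card_prefixes_segment_le[OF S, where Y = set])
    fix xs assume xs: "xs \<in> S"
    have "Suc (t - 1) < length xs" using xs S st length_vertex_hike[of xs] by auto
    then have "xs ! Suc (t - 1) \<in> set (take (Suc s) xs)"
      by (rule old_step_target_in_prefix) (use st old T[OF xs] in auto)
    then show "xs ! t \<in> set (take (Suc s) xs)" using st by simp
  next
    fix ys assume "ys \<in> prefixes S s"
    then obtain xs where xs: "xs \<in> vertex_hikes" "ys = take (Suc s) xs"
      using S by (auto simp: prefixes_def)
    show "set ys \<subseteq> verts G" using set_vertex_hike[OF xs(1)] xs(2) set_take_subset by fast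
    show "card (set ys) \<le> Suc (2 * k)"
      using card_length[of ys] xs length_vertex_hike[OF xs(1)] by simp
  qed (use st no_turn in auto)
  also have "\<dots> \<le> segment_factor * card (prefixes S s)"
    unfolding segment_factor_def using st by (intro mult_le_mono) auto
  finally show ?thesis .
qed

lemma prod_pattern_factor_old_segment:
  assumes "s < t" "is_cut T s" "\<And>j. s < j \<Longrightarrow> j < t \<Longrightarrow> \<not> is_cut T j"
    and old: "\<And>j. s \<le> j \<Longrightarrow> j < t \<Longrightarrow> j \<notin> T"
  shows "(\<Prod>j<t. pattern_factor T j) = segment_factor * (\<Prod>j<s. pattern_factor T j)"
proof -
  have "(\<Prod>j<t. pattern_factor T j) = (\<Prod>j<Suc s. pattern_factor T j)"
    using assms by (intro prod.mono_neutral_right) (auto simp: pattern_factor_def)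
  then show ?thesis using assms(1,2) old[of s] by (simp add: pattern_factor_def)
qed

lemma card_prefixes_le_prod_pattern_factor:
  assumes S: "S \<subseteq> vertex_hikes" and T: "\<And>xs. xs \<in> S \<Longrightarrow> new_steps xs = T" and "t \<le> 2 * k"
  shows "card (prefixes S t) \<le> card (verts G) * (\<Prod>j<t. pattern_factor T j)"
  using assms(3)
proof (induction t rule: less_induct)
  case (less t)
  consider (start) "t = 0" | (new_step) m where "t = Suc m" "m \<in> T"
    | (old_step) m where "t = Suc m" "m \<notin> T"
    by (cases t) auto
  then show ?case
  proof cases
    case start
    then show ?thesis using card_prefixes_0_le[OF S] by simp
  next
    case (new_step m)
    have "card (prefixes S t) \<le> step_factor m * card (prefixes S m)"
      using card_prefixes_Suc_le[OF S] new_step(1) less.prems by simp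
    also have "\<dots> \<le> step_factor m * (card (verts G) * (\<Prod>j<m. pattern_factor T j))"
      using less.IH[of m] new_step(1) less.prems by (intro mult_le_mono2) simp
    also have "\<dots> = card (verts G) * (\<Prod>j<t. pattern_factor T j)"
      using new_step by (simp add: pattern_factor_def)
    finally show ?thesis .
  next
    case (old_step m)
    obtain s where s: "s < t" "is_cut T s" "t - s \<le> R"
      and no_cut: "\<And>j. s < j \<Longrightarrow> j < t \<Longrightarrow> \<not> is_cut T j"
      using ex_last_cut[of t T] old_step(1) by auto
    have old: "j \<notin> T" if "s \<le> j" "j < t" for j
      using no_cut[of "Suc j"] that old_step by (cases "j = m") (auto simp: is_cut_def)
    have "card (prefixes S t) \<le> segment_factor * card (prefixes S s)"
      using no_cut by (intro card_prefixes_old_segment_le[OF S T s(1) less.prems s(3) _ old])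
        (auto simp: is_cut_def)
    also have "\<dots> \<le> segment_factor * (card (verts G) * (\<Prod>j<s. pattern_factor T j))"
      using less.IH[of s] s(1) less.prems by (intro mult_le_mono2) simp
    also have "\<dots> = card (verts G) * (\<Prod>j<t. pattern_factor T j)"
      using prod_pattern_factor_old_segment[OF s(1,2) no_cut old] by simp
    finally show ?thesis .
  qed
qed

lemma card_old_cuts_le:
  "card {j. j < 2 * k \<and> j \<notin> T \<and> is_cut T j} \<le> card (exits (2 * k) T) + 2 + 2 * k div R"
proof -
  let ?M = "{j. j < 2 * k \<and> R dvd j}" and ?E = "Suc ` exits (2 * k) T"
  have fin: "finite ?M" "finite ?E" using finite_exits by auto
  have "{j. j < 2 * k \<and> j \<notin> T \<and> is_cut T j} \<subseteq> insert k (?M \<union> ?E)"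
  proof
    fix j assume j: "j \<in> {j. j < 2 * k \<and> j \<notin> T \<and> is_cut T j}"
    then have "j \<in> ?E" if "0 < j" "j - 1 \<in> T"
      using that by (intro image_eqI[of _ _ "j - 1"]) (auto simp: exits_def)
    then show "j \<in> insert k (?M \<union> ?E)" using j by (auto simp: is_cut_def)
  qed
  then have "card {j. j < 2 * k \<and> j \<notin> T \<and> is_cut T j} \<le> card (insert k (?M \<union> ?E))"
    using fin by (intro card_mono) auto
  also have "\<dots> \<le> Suc (card ?M + card ?E)"
    using fin card_Un_le[of ?M ?E] by (simp add: card_insert_if)
  also have "\<dots> \<le> card (exits (2 * k) T) + 2 + 2 * k div R"
    using card_multiples_le[OF R_pos, of "2 * k"] by (simp add: card_image)
  finally show ?thesis .
qed

lemma prod_pattern_factor_le: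
  assumes T: "T \<subseteq> {..<2 * k}" "card T \<le> k" and q: "card (exits (2 * k) T) \<le> q"
  shows "(\<Prod>j<2 * k. pattern_factor T j) \<le>
    d\<^sup>2 * (d - 1) ^ k * segment_factor ^ (q + 2 + 2 * k div R)"
proof -
  let ?old_cuts = "{j. j < 2 * k \<and> j \<notin> T \<and> is_cut T j}"
  have fin_T: "finite T" using T(1) finite_lessThan by (rule finite_subset)
  have "(\<Prod>j<2 * k. pattern_factor T j) =
      (\<Prod>j\<in>{..<2 * k}. (if j \<in> T then step_factor j else 1) *
        (if j \<in> {j. j \<notin> T \<and> is_cut T j} then segment_factor else 1))"
    by (intro prod.cong) (auto simp: pattern_factor_def)
  also have "\<dots> = (\<Prod>j\<in>{..<2 * k} \<inter> T. step_factor j) *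
      segment_factor ^ card ({..<2 * k} \<inter> {j. j \<notin> T \<and> is_cut T j})"
    by (simp only: prod.distrib prod.inter_restrict[OF finite_lessThan, symmetric] prod_constant)
  also have "{..<2 * k} \<inter> T = T" using T(1) by blast
  also have "{..<2 * k} \<inter> {j. j \<notin> T \<and> is_cut T j} = ?old_cuts" by blast
  also have "(\<Prod>j\<in>T. step_factor j) * segment_factor ^ card ?old_cuts \<le>
      d\<^sup>2 * (d - 1) ^ k * segment_factor ^ (q + 2 + 2 * k div R)"
  proof (rule mult_le_mono)
    have "card (T \<inter> {0, k}) \<le> card {0, k}" by (intro card_mono) auto
    also have "\<dots> \<le> 2" by (simp add: card_insert_if)
    finally have "d ^ card (T \<inter> {0, k}) * (d - 1) ^ card T \<le> d\<^sup>2 * (d - 1) ^ k"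
      using T(2) two_le_d by (intro mult_le_mono power_increasing) auto
    then show "(\<Prod>j\<in>T. step_factor j) \<le> d\<^sup>2 * (d - 1) ^ k"
      using prod_step_factor_le[OF fin_T] by (rule order_trans[rotated])
    show "segment_factor ^ card ?old_cuts \<le> segment_factor ^ (q + 2 + 2 * k div R)"
      using card_old_cuts_le[of T] q by (intro power_increasing) (auto simp: segment_factor_def)
  qed
  finally show ?thesis .
qed

lemma card_hikes_few_edges_le:
  fixes \<delta> :: real
  defines "q \<equiv> nat \<lfloor>2 + \<delta> * real (Suc k)\<rfloor>"
  assumes "0 < k" and \<delta>: "0 \<le> \<delta>" "real (Suc k) \<le> (1 + \<delta>) ^ R"
  shows "card {xs \<in> vertex_hikes. card (walk_edges xs) \<le> k} \<le>
    card (verts G) * (d\<^sup>2 * (d - 1) ^ k * segment_factor ^ (q + 2 + 2 * k div R)) *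
      Suc (2 * k) ^ (2 * q)"
proof -
  let ?S = "{xs \<in> vertex_hikes. card (walk_edges xs) \<le> k}"
  let ?c = "card (verts G) * (d\<^sup>2 * (d - 1) ^ k * segment_factor ^ (q + 2 + 2 * k div R))"
  have pattern: "T \<subseteq> {..<2 * k} \<and> 0 \<in> T \<and> card T \<le> k \<and> card (exits (2 * k) T) \<le> q"
    if T: "T \<in> new_steps ` ?S" for T
  proof -
    obtain xs where xs: "xs \<in> vertex_hikes" "card (walk_edges xs) \<le> k" "T = new_steps xs"
      using T by blast
    have "card (exits (2 * k) T) \<le> q"
      using card_exits_new_steps_le[OF xs(1,2) \<delta>] unfolding q_def xs(3) by (rule le_nat_floor)
    then show ?thesis
      using xs length_vertex_hike[OF xs(1)] card_new_steps[of xs] \<open>0 < k\<close>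
      by (auto simp: new_steps_def)
  qed
  have "card ?S = (\<Sum>T\<in>new_steps ` ?S. card {xs \<in> ?S. new_steps xs = T})"
    using finite_vertex_hikes by (intro card_eq_sum_fibres) simp
  also have "\<dots> \<le> of_nat (card (new_steps ` ?S)) * ?c"
  proof (rule sum_bounded_above)
    fix T assume T: "T \<in> new_steps ` ?S"
    let ?S\<^sub>T = "{xs \<in> ?S. new_steps xs = T}"
    have sub: "?S\<^sub>T \<subseteq> vertex_hikes" by blast
    have "card (prefixes ?S\<^sub>T (2 * k)) \<le> card (verts G) * (\<Prod>j<2 * k. pattern_factor T j)"
      by (rule card_prefixes_le_prod_pattern_factor[OF sub]) auto
    also have "\<dots> \<le> ?c"
      using prod_pattern_factor_le[of T q] pattern[OF T] by (intro mult_le_mono2) simp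
    finally show "card ?S\<^sub>T \<le> ?c" by (simp only: prefixes_full[OF sub])
  qed
  also have "\<dots> \<le> Suc (2 * k) ^ (2 * q) * ?c"
    unfolding of_nat_id using pattern by (intro mult_le_mono1 card_patterns_le) blast
  finally show ?thesis by (simp only: mult.commute)
qed

end

section \<open>Hikes as arc walks\<close>

lemma singleton_free_card_uedges_le:
  assumes "singleton_free G p"
  shows "2 * card (uedge G ` set p) \<le> length p"
proof -
  let ?f = "\<lambda>i. uedge G (p ! i)"
  have edges: "uedge G ` set p = ?f ` {..<length p}"
    by (auto simp: set_conv_nth)
  have "of_nat (card (?f ` {..<length p})) * 2 \<le>
      (\<Sum>e\<in>?f ` {..<length p}. card {i \<in> {..<length p}. ?f i = e})"
  proof (rule sum_bounded_below)
    fix e assume "e \<in> ?f ` {..<length p}"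
    then show "2 \<le> card {i \<in> {..<length p}. ?f i = e}"
      using assms by (auto simp: singleton_free_def)
  qed
  also have "\<dots> = length p" using card_eq_sum_fibres[of "{..<length p}" ?f] by simp
  finally show ?thesis by (simp add: edges mult.commute)
qed

context graph
begin

lemma awalk_cost_one: "awalk_cost (\<lambda>_. 1) p = real (length p)"
  by (induction p) auto

lemma neighborhood_eq_induce_ball:
  assumes r: "0 \<le> r"
  shows "neighborhood G r x = G \<restriction> ball x (nat \<lfloor>r\<rfloor>)"
proof -
  have "{w \<in> verts G. \<mu> (\<lambda>_. 1) x w \<le> ereal r} = ball x (nat \<lfloor>r\<rfloor>)"
  proof (intro set_eqI iffI)
    fix w assume "w \<in> {w \<in> verts G. \<mu> (\<lambda>_. 1) x w \<le> ereal r}"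
    then have "\<mu> (\<lambda>_. 1) x w \<le> ereal r" by simp
    also have "\<dots> < ereal (real (Suc (nat \<lfloor>r\<rfloor>)))" using r by (simp, linarith)
    finally obtain p where "awalk x p w" "length p < Suc (nat \<lfloor>r\<rfloor>)"
      unfolding \<mu>_def INF_less_iff awalk_cost_one by auto
    then show "w \<in> ball x (nat \<lfloor>r\<rfloor>)" unfolding ball_def by auto
  next
    fix w assume w: "w \<in> ball x (nat \<lfloor>r\<rfloor>)"
    then obtain p where p: "awalk x p w" "length p \<le> nat \<lfloor>r\<rfloor>" by (auto simp: ball_def)
    have "\<mu> (\<lambda>_. 1) x w \<le> ereal (awalk_cost (\<lambda>_. 1) p)" by (rule min_cost_le_walk_cost[OF p(1)])
    also have "\<dots> \<le> ereal r" using p(2) r unfolding awalk_cost_one by (simp, linarith)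
    finally show "w \<in> {w \<in> verts G. \<mu> (\<lambda>_. 1) x w \<le> ereal r}" using w ball_subset_verts by auto
  qed
  then show ?thesis by (simp add: neighborhood_def)
qed

lemma awalk_verts_nth:
  assumes "cas u p v" "i < length p"
  shows "awalk_verts u p ! i = tail G (p ! i)" "awalk_verts u p ! Suc i = head G (p ! i)"
proof -
  have "p \<noteq> []" using assms by auto
  then show "awalk_verts u p ! Suc i = head G (p ! i)"
    using awalk_verts_conv'[OF assms(1)] assms(2) by simp
  show "awalk_verts u p ! i = tail G (p ! i)"
    using awalk_verts_conv[of u p] \<open>p \<noteq> []\<close> assms(2) by (simp add: nth_append)
qed

lemma inj_on_awalk_verts: "inj_on (\<lambda>(u, p). awalk_verts u p) {(u, p). \<exists>v. awalk u p v}"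
proof (rule inj_onI, clarify)
  fix u p v u' p' v'
  assume walks: "awalk u p v" "awalk u' p' v'" and verts: "awalk_verts u p = awalk_verts u' p'"
  have len: "length p = length p'" using verts length_awalk_verts by (metis Suc_inject)
  have "p = p'"
  proof (rule nth_equalityI[OF len])
    fix i assume i: "i < length p"
    have "tail G (p ! i) = tail G (p' ! i)" "head G (p ! i) = head G (p' ! i)"
      using awalk_verts_nth[of u p v i] awalk_verts_nth[of u' p' v' i] walks i len verts
      by (auto simp: awalk_def)
    then show "p ! i = p' ! i"
      using walks i len by (intro no_multi_arcs) (auto simp: arc_to_ends_def awalk_def)
  qed
  moreover have "u = u'" using verts walks awhd_of_awalk by metis
  ultimately show "u = u' \<and> p = p'" by simp
qed

lemma walk_edges_awalk_verts:
  assumes "cas u p v"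
  shows "walk_edges (awalk_verts u p) = uedge G ` set p"
proof -
  have "step_edge (awalk_verts u p) i = uedge G (p ! i)" if "i < length p" for i
    using awalk_verts_nth[OF assms that] by (simp add: step_edge_def uedge_def)
  then have "walk_edges (awalk_verts u p) = (\<lambda>i. uedge G (p ! i)) ` {i. i < length p}"
    by (simp add: walk_edges_def length_awalk_verts)
  also have "\<dots> = uedge G ` set p" by (auto simp: set_conv_nth)
  finally show ?thesis .
qed

end

context hike_graph
begin

lemma awalk_verts_in_vertex_hikes:
  assumes "hike G k u p"
  shows "awalk_verts u p \<in> vertex_hikes"
proof -
  let ?xs = "awalk_verts u p"
  have walk: "awalk u p u" and len: "length p = 2 * k"
    and turn: "\<And>i. Suc i < length p \<Longrightarrow> Suc i \<noteq> k \<Longrightarrow> \<not> is_reverse G (p ! i) (p ! Suc i)"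
    using assms by (auto simp: hike_def)
  have cas: "cas u p u" using walk by (simp add: awalk_def)
  note nth = awalk_verts_nth[OF cas]
  have "successively (\<lambda>u v. u \<rightarrow>\<^bsub>G\<^esub> v) ?xs"
    unfolding successively_conv_nth
  proof (intro allI impI)
    fix i assume "Suc i < length ?xs"
    then have i: "i < length p" by (simp add: length_awalk_verts)
    then have "p ! i \<in> arcs G" using walk by (auto simp: awalk_def)
    then show "?xs ! i \<rightarrow>\<^bsub>G\<^esub> ?xs ! Suc i" using nth[OF i] by (auto simp: arcs_ends_conv)
  qed
  moreover have "?xs ! i \<noteq> ?xs ! Suc (Suc i)" if "Suc (Suc i) < length ?xs" "Suc i \<noteq> k" for i
  proof -
    have i: "Suc i < length p" using that(1) by (simp add: length_awalk_verts)
    have "tail G (p ! Suc i) = head G (p ! i)" using nth(2)[of i] nth(1)[OF i] i by simp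
    then have "tail G (p ! i) \<noteq> head G (p ! Suc i)"
      using turn[OF i that(2)] by (auto simp: is_reverse_def)
    then show ?thesis using nth(1)[of i] nth(2)[OF i] i by simp
  qed
  moreover have "set ?xs \<subseteq> verts G" using walk by blast
  ultimately show ?thesis using walk len by (simp add: vertex_hikes_def length_awalk_verts)
qed

lemma card_singleton_free_hikes_le:
  "card (singleton_free_hikes G k) \<le> card {xs \<in> vertex_hikes. card (walk_edges xs) \<le> k}"
proof (rule card_inj_on_le)
  show "inj_on (\<lambda>(u, p). awalk_verts u p) (singleton_free_hikes G k)"
    by (rule inj_on_subset[OF inj_on_awalk_verts]) (auto simp: singleton_free_hikes_def hike_def)
  show "finite {xs \<in> vertex_hikes. card (walk_edges xs) \<le> k}" using finite_vertex_hikes by simp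
  show "(\<lambda>(u, p). awalk_verts u p) ` singleton_free_hikes G k \<subseteq>
    {xs \<in> vertex_hikes. card (walk_edges xs) \<le> k}"
  proof clarify
    fix u p assume "(u, p) \<in> singleton_free_hikes G k"
    then have hike: "hike G k u p" and free: "singleton_free G p"
      by (simp_all add: singleton_free_hikes_def)
    then have "card (walk_edges (awalk_verts u p)) = card (uedge G ` set p)"
      using walk_edges_awalk_verts[of u p u] by (simp add: hike_def awalk_def)
    then show "awalk_verts u p \<in> vertex_hikes \<and> card (walk_edges (awalk_verts u p)) \<le> k"
      using singleton_free_card_uedges_le[OF free] hike awalk_verts_in_vertex_hikes
      by (simp add: hike_def)
  qed
qed

end

section \<open>The bound\<close>

lemma exp_half_le_one_plus_power:
  assumes "0 \<le> x" "x \<le> real n"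
  shows "exp (x / 2) \<le> (1 + x / real n) ^ n"
proof (cases "n = 0")
  case False
  then have "exp (x / (2 * real n)) \<le> 1 + 2 * (x / (2 * real n))"
    using exp_bound_lemma[of "x / (2 * real n)"] assms by (simp add: field_simps)
  then have "exp (x / (2 * real n)) ^ n \<le> (1 + x / real n) ^ n" by (intro power_mono) auto
  moreover have "exp (x / (2 * real n)) ^ n = exp (x / 2)"
    using False by (simp flip: exp_of_nat_mult)
  ultimately show ?thesis by simp
qed (use assms in simp)

lemma half_le_ln:
  assumes "2 \<le> x"
  shows "1 / 2 \<le> ln (x :: real)"
  using exp_half_le2 assms by (subst ln_ge_iff) auto

lemma five_le_radius:
  fixes l r :: real
  assumes "1 \<le> l" "10 * ln (2 * l) \<le> r"
  shows "5 \<le> r"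
  using half_le_ln[of "2 * l"] assms by linarith

lemma exponent_le:
  fixes l r \<rho> :: real
  assumes l: "2 \<le> l" and r: "2 \<le> r" "r \<le> l" and \<rho>: "r - 1 \<le> \<rho>"
    and q: "q \<le> 2 + 2 * ln l / \<rho> * l" and m: "m \<le> 2 * l / \<rho>"
  shows "6 + 4 * q + 2 * m \<le> 60 * (ln l / r) * l"
proof -
  define a where "a = l / r"
  have ln: "1 / 2 \<le> ln l" using l by (rule half_le_ln)
  have a: "1 \<le> a" using r by (simp add: a_def)
  have "l / \<rho> \<le> l / (r / 2)" using \<rho> r l by (intro divide_left_mono) auto
  then have l_\<rho>: "l / \<rho> \<le> 2 * a" by (simp add: a_def mult.commute)
  have "2 * ln l * (l / \<rho>) \<le> 2 * ln l * (2 * a)" using l_\<rho> ln by (intro mult_left_mono) auto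
  then have "q \<le> 2 + 4 * (ln l * a)" using q by simp
  moreover have a_le: "a \<le> 2 * (ln l * a)" using mult_right_mono[OF ln, of a] a by simp
  then have "m \<le> 8 * (ln l * a)" using m l_\<rho> by simp
  moreover have "1 / 2 \<le> ln l * a" using a_le a by linarith
  ultimately have "6 + 4 * q + 2 * m \<le> 60 * (ln l * a)" by simp
  then show ?thesis by (simp add: a_def)
qed

context hike_graph
begin

lemma factors_le_base:
  fixes r :: real
  defines "Q \<equiv> real d * r * real (Suc k)"
  assumes "0 < k" "5 \<le> r" "real R \<le> r"
  shows "real d \<le> Q" "real (Suc (2 * k)) \<le> Q" "real segment_factor \<le> Q\<^sup>2"
proof -
  have "1 * 1 \<le> r * real (Suc k)" using assms by (intro mult_mono) auto
  then have "real d * 1 \<le> real d * (r * real (Suc k))" by (intro mult_left_mono) auto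
  then show "real d \<le> Q" by (simp add: Q_def mult.assoc)
  have "2 * 1 * real (Suc k) \<le> Q" unfolding Q_def using assms two_le_d by (intro mult_mono) auto
  then show vertices: "real (Suc (2 * k)) \<le> Q" by simp
  have "real (2 * Suc R) \<le> 2 * r * 2" using assms by simp
  also have "\<dots> \<le> Q" unfolding Q_def using assms two_le_d by (intro mult_mono) auto
  finally have "real (Suc (2 * k)) * real (2 * Suc R) \<le> Q * Q"
    using vertices by (intro mult_mono) auto
  then show "real segment_factor \<le> Q\<^sup>2"
    unfolding segment_factor_def of_nat_mult[of "Suc (2 * k)"] by (simp only: power2_eq_square)
qed

lemma prod_factors_le_powr:
  fixes r :: real and q :: nat
  defines "l \<equiv> real (Suc k)"
  assumes r: "5 \<le> r" "r - 1 \<le> real R" "real R \<le> r" and k: "R < k"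
    and q: "real q \<le> 2 + 2 * ln l / real R * l"
  shows "real d ^ 2 * real segment_factor ^ (q + 2 + 2 * k div R) * real (Suc (2 * k)) ^ (2 * q)
    \<le> (real d * r * l) powr (60 * (ln l / r) * l)"
proof -
  define Q where "Q = real d * r * l"
  let ?e = "q + 2 + 2 * k div R"
  have factors: "real d \<le> Q" "real (Suc (2 * k)) \<le> Q" "real segment_factor \<le> Q\<^sup>2"
    unfolding Q_def l_def using r k by (intro factors_le_base; simp)+
  then have Q: "1 \<le> Q" using two_le_d by linarith
  have "real d ^ 2 * real segment_factor ^ ?e * real (Suc (2 * k)) ^ (2 * q) \<le>
      Q ^ 2 * (Q\<^sup>2) ^ ?e * Q ^ (2 * q)"
    using factors Q by (intro mult_mono power_mono) auto
  also have "\<dots> = Q ^ (2 + 2 * ?e + 2 * q)" by (simp only: power_add power_mult)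
  also have "\<dots> = Q powr real (2 + 2 * ?e + 2 * q)" using Q by (subst powr_realpow) auto
  also have "\<dots> \<le> Q powr (60 * (ln l / r) * l)"
  proof (rule powr_mono)
    have "real (2 * k div R) \<le> real (2 * k) / real R" by (rule of_nat_div_le_of_nat)
    also have "\<dots> \<le> 2 * l / real R" by (intro divide_right_mono) (simp_all add: l_def)
    finally show "real (2 + 2 * ?e + 2 * q) \<le> 60 * (ln l / r) * l"
      using exponent_le[of l r "real R" "real q" "real (2 * k div R)"] r k q by (simp add: l_def)
  qed (rule Q)
  finally show ?thesis by (simp only: Q_def)
qed

lemma card_singleton_free_hikes_le_long:
  fixes r :: real
  defines "l \<equiv> real (Suc k)"
  assumes r: "5 \<le> r" "r - 1 \<le> real R" "real R \<le> r" and ln: "2 * ln l \<le> real R" and k: "R < k"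
  shows "real (card (singleton_free_hikes G k)) \<le>
    real (card (verts G)) * (real d - 1) ^ k * (real d * r * l) powr (60 * (ln l / r) * l)"
proof -
  define \<delta> where "\<delta> = 2 * ln l / real R"
  define q where "q = nat \<lfloor>2 + \<delta> * l\<rfloor>"
  let ?n = "real (card (verts G))" and ?e = "q + 2 + 2 * k div R"
  have l: "1 \<le> l" by (simp add: l_def)
  have \<delta>: "0 \<le> \<delta>" using l by (simp add: \<delta>_def)
  have "l = exp (2 * ln l / 2)" using l by simp
  also have "\<dots> \<le> (1 + \<delta>) ^ R" unfolding \<delta>_def using ln l by (intro exp_half_le_one_plus_power) auto
  finally have growth: "real (Suc k) \<le> (1 + \<delta>) ^ R" by (simp add: l_def)
  have q: "real q \<le> 2 + 2 * ln l / real R * l"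
    unfolding q_def using \<delta> l by (simp add: \<delta>_def)
  note card_singleton_free_hikes_le
  also have "card {xs \<in> vertex_hikes. card (walk_edges xs) \<le> k} \<le>
      card (verts G) * (d\<^sup>2 * (d - 1) ^ k * segment_factor ^ ?e) * Suc (2 * k) ^ (2 * q)"
    unfolding q_def l_def using k by (intro card_hikes_few_edges_le \<delta> growth) simp
  finally have "real (card (singleton_free_hikes G k)) \<le>
      real (card (verts G) * (d\<^sup>2 * (d - 1) ^ k * segment_factor ^ ?e) * Suc (2 * k) ^ (2 * q))"
    by (rule of_nat_mono)
  also have "\<dots> = ?n * (real d - 1) ^ k *
      (real d ^ 2 * real segment_factor ^ ?e * real (Suc (2 * k)) ^ (2 * q))"
    using two_le_d by (simp add: of_nat_diff ac_simps del: of_nat_Suc One_nat_def)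
  also have "\<dots> \<le> ?n * (real d - 1) ^ k * (real d * r * l) powr (60 * (ln l / r) * l)"
    using prod_factors_le_powr[OF r k] q two_le_d by (intro mult_left_mono) (auto simp: l_def)
  finally show ?thesis .
qed

lemma card_singleton_free_hikes_le_short:
  assumes "k \<le> R"
  shows "card (singleton_free_hikes G k) \<le> 4 * Suc k * (card (verts G) * (d - 1) ^ Suc k)"
proof -
  note card_singleton_free_hikes_le
  also have "card {xs \<in> vertex_hikes. card (walk_edges xs) \<le> k} \<le> card vertex_hikes"
    using finite_vertex_hikes by (intro card_mono) auto
  also have "\<dots> \<le> 2 * Suc k * (card (verts G) * (d * (d - 1) ^ k))"
    by (rule card_vertex_hikes_le[OF assms])
  also have "\<dots> \<le> 2 * Suc k * (card (verts G) * (2 * (d - 1) * (d - 1) ^ k))"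
    using two_le_d by (intro mult_le_mono) auto
  also have "\<dots> = 4 * Suc k * (card (verts G) * (d - 1) ^ Suc k)"
    by (simp only: power_Suc ac_simps)
  finally show ?thesis .
qed

lemma one_le_powr_factor:
  fixes r :: real
  assumes "1 \<le> r"
  shows "1 \<le> (real d * r * real (Suc k)) powr (60 * (ln (real (Suc k)) / r) * real (Suc k))"
proof (rule ge_one_powr_ge_zero)
  have "1 * 1 * 1 \<le> real d * r * real (Suc k)" using two_le_d assms by (intro mult_mono) auto
  then show "1 \<le> real d * r * real (Suc k)" by simp
qed (use assms in simp)

lemma card_singleton_free_hikes_le_powr:
  fixes r :: real
  defines "l \<equiv> real (Suc k)"
  assumes r: "10 * ln (2 * l) \<le> r" and R: "R = nat \<lfloor>r\<rfloor>"
  shows "real (card (singleton_free_hikes G k)) \<le>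
    4 * (l ^ 3 * real (card (verts G))) * (real d - 1) ^ Suc k *
      (real d * r * l) powr (60 * (ln l / r) * l)"
proof -
  define X where "X = real (card (verts G)) * (real d - 1) ^ Suc k"
  define P where "P = (real d * r * l) powr (60 * (ln l / r) * l)"
  have l: "1 \<le> l" by (simp add: l_def)
  then have r5: "5 \<le> r" using r by (rule five_le_radius)
  then have R_bounds: "r - 1 \<le> real R" "real R \<le> r" unfolding R by linarith+
  have d: "1 \<le> real d - 1" using two_le_d by simp
  then have X: "0 \<le> X" by (simp add: X_def)
  have P: "1 \<le> P" unfolding P_def l_def using r5 by (intro one_le_powr_factor) simp
  have "real (card (singleton_free_hikes G k)) \<le> 4 * l ^ 3 * (X * P)"
  proof (cases "k \<le> R")
    case True
    have "real (card (singleton_free_hikes G k)) \<le>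
        real (4 * Suc k * (card (verts G) * (d - 1) ^ Suc k))"
      by (intro of_nat_mono card_singleton_free_hikes_le_short[OF True])
    also have "\<dots> = 4 * l * (X * 1)"
      using two_le_d
      by (simp add: X_def l_def of_nat_diff del: of_nat_Suc power_Suc mult_Suc_right One_nat_def)
    also have "\<dots> \<le> 4 * l ^ 3 * (X * P)"
      using l P X by (intro mult_mono self_le_power) auto
    finally show ?thesis .
  next
    case False
    have "ln l \<le> ln (2 * l)" using l by simp
    then have "2 * ln l \<le> real R" using r r5 l R_bounds(1) by linarith
    then have "real (card (singleton_free_hikes G k)) \<le>
        real (card (verts G)) * (real d - 1) ^ k * P"
      unfolding P_def l_def using r5 R_bounds False
      by (intro card_singleton_free_hikes_le_long) auto
    also have "\<dots> \<le> X * P"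
      unfolding X_def using d P by (intro mult_right_mono mult_left_mono power_increasing) auto
    also have "\<dots> \<le> 4 * l ^ 3 * (X * P)"
      using mult_right_mono[of 1 "4 * l ^ 3" "X * P"] one_le_power[OF l, of 3] X P by simp
    finally show ?thesis .
  qed
  then show ?thesis by (simp add: X_def P_def mult.assoc)
qed

end

theorem theorem3p9:
  shows "\<exists>C\<^sub>1 > (0::real). \<exists>C\<^sub>2 > (0::real).
    \<forall>(G :: ('a, 'b) pre_digraph) (n::nat) (d::nat) (l::nat) (r::real).
      graph G \<longrightarrow> card (verts G) = n \<longrightarrow> regular G d \<longrightarrow> 2 \<le> d \<longrightarrow> 1 \<le> l \<longrightarrow>
      10 * ln (2 * real l) \<le> r \<longrightarrow> bicycle_free_at_radius G r \<longrightarrow>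
      real (card (singleton_free_hikes G (l - 1)))
        \<le> C\<^sub>1 * (real l ^ 3 * real n) * (real d - 1) ^ l
            * (real d * r * real l) powr (C\<^sub>2 * (ln (real l) / r) * real l)"
proof -
  have "real (card (singleton_free_hikes G (l - 1)))
        \<le> 4 * (real l ^ 3 * real (card (verts G))) * (real d - 1) ^ l
            * (real d * r * real l) powr (60 * (ln (real l) / r) * real l)"
    if "graph G" and regular: "regular G d" "2 \<le> d" and l: "1 \<le> l" and r: "10 * ln (2 * real l) \<le> r"
      and free: "bicycle_free_at_radius G r"
    for G :: "('a, 'b) pre_digraph" and d l :: nat and r :: real
  proof -
    interpret graph G by fact
    have r5: "5 \<le> r" using l r by (intro five_le_radius[of "real l"]) simp_all
    interpret hike_graph G "nat \<lfloor>r\<rfloor>" d "l - 1"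
    proof unfold_locales
      fix v assume v: "v \<in> verts G"
      show "bicycle_free (G \<restriction> ball v (nat \<lfloor>r\<rfloor>))"
        using free v r5 by (simp add: bicycle_free_at_radius_def flip: neighborhood_eq_induce_ball)
      show "out_degree G v \<le> d" using regular(1) v by (simp add: regular_def)
    qed (use regular(2) r5 in auto)
    show ?thesis using card_singleton_free_hikes_le_powr[of r] l r by simp
  qed
  then show ?thesis by (intro exI[of _ 4] conjI exI[of _ 60] allI impI) auto
qed

end
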